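(* The following identities hold in the ring of formal power series in the variables $x_1,x_2,x_3,\ldots$ (empty products equal $1$): $$\sum_{\lambda\in\mathcal{P}_1}x^{\lambda}=1+\sum_{n=1}^{\infty}\frac{X_n^2\Big(\prod_{i=1}^{n-1}(1+X_{i-1}^3X_i)\Big)(1+X_{n-1}^3/X_n)}{\prod_{i=1}^{n}(1-X_i^2)}=\prod_{i=1}^{\infty}\frac{1+X_{i-1}^3X_i}{1-X_i^2},$$ $$\sum_{\lambda\in\mathcal{P}_2}x^{\lambda}=1+\sum_{n=1}^{\infty}\frac{X_n^2\Big(\prod_{i=1}^{n-1}(1+X_{i-1}X_i^3)\Big)(1+X_{n-1}X_n)}{\prod_{i=1}^{n}(1-X_i^2)}=\prod_{i=1}^{\infty}\frac{1+X_{i-1}X_i^3}{1-X_i^2},$$ $$\sum_{\lambda\in\mathcal{P}'_1}x^{\lambda}=1+\sum_{n=1}^{\infty}\frac{X_{2n}^{2}\Big(\prod_{i=1}^{n-1}(1+X_{2i-2}X_{2i-1})\Big)(1+X_{2n-2}X_{2n-1}/X_{2n}^2)}{\prod_{i=1}^{2n}(1-X_i^2)}+\sum_{n=0}^{\infty}\frac{X_{2n+1}^{2}\prod_{i=1}^{n}(1+X_{2i-2}X_{2i-1})}{\prod_{i=1}^{2n+1}(1-X_i^2)}=\prod_{i=1}^{\infty}\frac{1+X_{2i-2}X_{2i-1}}{(1-X_{2i-1}^2)(1-X_{2i}^2)},$$ $$\sum_{\lambda\in\mathcal{P}'_2}x^{\lambda}=1+\sum_{n=1}^{\infty}\frac{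X_{2n}^2\Big(\prod_{i=1}^{n-1}(1+X_{2i-1}X_{2i})\Big)(1+X_{2n-1}/X_{2n})}{\prod_{i=1}^{2n}(1-X_i^2)}+\sum_{n=0}^{\infty}\frac{X_{2n+1}^2\prod_{i=1}^{n}(1+X_{2i-1}X_{2i})}{\prod_{i=1}^{2n+1}(1-X_i^2)}=\prod_{i=1}^{\infty}\frac{1+X_{2i-1}X_{2i}}{(1-X_{2i-1}^2)(1-X_{2i}^2)}.$$
   Context: A partition is a finite weakly decreasing sequence of positive integers $\lambda=(\lambda_1,\ldots,\lambda_\ell)$ (the empty partition, $\ell=0$, is included); $\ell=\ell(\lambda)$ is its length. The odd-indexed parts are $\lambda_1,\lambda_3,\lambda_5,\ldots$ and the even-indexed parts are $\lambda_2,\lambda_4,\lambda_6,\ldots$. $\mathcal{P}_1$ is the set of partitions such that for all $1\le i<\ell(\lambda)$, $\lambda_i-\lambda_{i+1}\geq3$ if $\lambda_{i+1}$ is odd. $\mathcal{P}_2$ is the set of partitions with all parts at least $2$ such that for all $1\le i<\ell(\lambda)$, $\lambda_i-\lambda_{i+1}\geq3$ if $\lambda_i$ is odd. $\mathcal{P}_1'$ is the set of partitions whose even-indexed parts are all even. $\mathcal{P}_2'$ is the set of partitions whose odd-indexed parts are all even. The empty partition belongs to all four sets. For commuting variables $x_1,x_2,\ldots$ put $x^{\lambda}:=x_1^{\lambda_1}x_2^{\lambda_2}\cdots x_\ell^{\lambda_\ell}$ (with $x^{\emptyset}=1$), $X_i:=x_1x_2\cdots x_i$ for $i\ge1$, and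 $X_i:=1$ for $i\leq 0$. Quotients such as $X_{n-1}^3/X_n$ always occur multiplied by monomials that clear the denominator, so every summand is a formal power series. *)

theory Defs
  imports
    "HOL-Analysis.Infinite_Sum"
    "HOL-Analysis.Infinite_Products"
    "HOL-Computational_Algebra.Polynomial_Factorial"
    "HOL-Library.Poly_Mapping"
begin

section \<open>Formal power series in arbitrarily many variables\<close>

text \<open>
  A power series with coefficients in \<open>'a\<close> and variables indexed by \<open>'v\<close> is an arbitrary
  function from exponent vectors to \<open>'a\<close>. An exponent vector is a finitely supported function
  \<open>'v \<Rightarrow>\<^sub>0 nat\<close>, so only the monomials are finite; a series may involve infinitely many variables
  and may contain infinitely many monomials of a given degree.
\<close>

typedef ('v, 'a) mfps = "UNIV :: (('v \<Rightarrow>\<^sub>0 nat) \<Rightarrow> 'a) set"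
  morphisms mcoeff Abs_mfps
  by simp

setup_lifting type_definition_mfps

lemma mfps_eqI: "(\<And>m. mcoeff f m = mcoeff g m) \<Longrightarrow> f = g"
  by (metis ext mcoeff_inject)

text \<open>The factorisations of the monomial with exponent vector \<open>m\<close> into two monomials.\<close>

definition splits :: "('v \<Rightarrow>\<^sub>0 nat) \<Rightarrow> (('v \<Rightarrow>\<^sub>0 nat) \<times> ('v \<Rightarrow>\<^sub>0 nat)) set" where
  "splits m = {(a, b). a + b = m}"

lemma splits_iff [simp]: "(a, b) \<in> splits m \<longleftrightarrow> a + b = m"
  by (simp add: splits_def)

lemma finite_dominated_exponents:
  fixes m :: "'v \<Rightarrow>\<^sub>0 nat"
  shows "finite {a. \<forall>v. Poly_Mapping.lookup a v \<le> Poly_Mapping.lookup m v}"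
    (is "finite ?D")
proof (rule finite_imageD)
  let ?K = "Poly_Mapping.keys m"
  let ?N = "Max (Poly_Mapping.lookup m ` ?K)"
  let ?F = "{f. \<forall>v. (v \<in> ?K \<longrightarrow> f v \<in> {..?N}) \<and> (v \<notin> ?K \<longrightarrow> f v = 0)}"
  show "inj_on Poly_Mapping.lookup ?D"
    by (simp add: inj_on_def lookup_inject)
  have "finite ?F"
    by (rule finite_set_of_finite_funs) auto
  moreover have "Poly_Mapping.lookup ` ?D \<subseteq> ?F"
  proof (rule image_subsetI)
    fix a assume "a \<in> ?D"
    then have a: "Poly_Mapping.lookup a v \<le> Poly_Mapping.lookup m v" for v by simp
    have "Poly_Mapping.lookup a v \<le> ?N" if "v \<in> ?K" for v
      using a[of v] Max_ge[of "Poly_Mapping.lookup m ` ?K" "Poly_Mapping.lookup m v"] that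
      by (auto intro: order_trans)
    moreover have "Poly_Mapping.lookup a v = 0" if "v \<notin> ?K" for v
      using a[of v] that by (simp add: in_keys_iff)
    ultimately show "Poly_Mapping.lookup a \<in> ?F" by simp
  qed
  ultimately show "finite (Poly_Mapping.lookup ` ?D)"
    by (rule rev_finite_subset)
qed

lemma finite_splits [simp]: "finite (splits m)"
proof (rule finite_subset)
  show "splits m \<subseteq> {a. \<forall>v. Poly_Mapping.lookup a v \<le> Poly_Mapping.lookup m v} \<times> {a. \<forall>v. Poly_Mapping.lookup a v \<le> Poly_Mapping.lookup m v}"
    by (auto simp: splits_def lookup_add)
qed (intro finite_cartesian_product finite_dominated_exponents)

instantiation mfps :: (type, zero) zero
begin
lift_definition zero_mfps :: "('a, 'b) mfps" is "\<lambda>_. 0" .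
instance ..
end

instantiation mfps :: (type, zero_neq_one) one
begin
lift_definition one_mfps :: "('a, 'b) mfps" is "\<lambda>m. if m = 0 then 1 else 0" .
instance ..
end

instantiation mfps :: (type, plus) plus
begin
lift_definition plus_mfps :: "('a, 'b) mfps \<Rightarrow> ('a, 'b) mfps \<Rightarrow> ('a, 'b) mfps"
  is "\<lambda>f g m. f m + g m" .
instance ..
end

instantiation mfps :: (type, uminus) uminus
begin
lift_definition uminus_mfps :: "('a, 'b) mfps \<Rightarrow> ('a, 'b) mfps" is "\<lambda>f m. - f m" .
instance ..
end

instantiation mfps :: (type, minus) minus
begin
lift_definition minus_mfps :: "('a, 'b) mfps \<Rightarrow> ('a, 'b) mfps \<Rightarrow> ('a, 'b) mfps"
  is "\<lambda>f g m. f m - g m" .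
instance ..
end

instantiation mfps :: (type, "{comm_monoid_add, times}") times
begin
lift_definition times_mfps :: "('a, 'b) mfps \<Rightarrow> ('a, 'b) mfps \<Rightarrow> ('a, 'b) mfps"
  is "\<lambda>f g m. \<Sum>(a, b)\<in>splits m. f a * g b" .
instance ..
end

lemma mcoeff_0 [simp]: "mcoeff 0 m = 0" by transfer simp
lemma mcoeff_1: "mcoeff 1 m = (if m = 0 then 1 else 0)" by transfer simp
lemma mcoeff_add [simp]: "mcoeff (f + g) m = mcoeff f m + mcoeff g m" by transfer simp
lemma mcoeff_uminus [simp]: "mcoeff (- f) m = - mcoeff f m" by transfer simp
lemma mcoeff_diff [simp]: "mcoeff (f - g) m = mcoeff f m - mcoeff g m" by transfer simp
lemma mcoeff_mult: "mcoeff (f * g) m = (\<Sum>(a, b)\<in>splits m. mcoeff f a * mcoeff g b)"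
  by transfer simp

instance mfps :: (type, comm_ring_1) comm_ring_1
proof
  fix f g h :: "('a, 'b) mfps"
  show "f + g + h = f + (g + h)" "f + g = g + f" "0 + f = f" "- f + f = 0" "f - g = f + - g"
    by (auto intro!: mfps_eqI simp: algebra_simps)
  show "(0 :: ('a, 'b) mfps) \<noteq> 1"
  proof
    assume eq: "(0 :: ('a, 'b) mfps) = 1"
    have "mcoeff (0 :: ('a, 'b) mfps) 0 \<noteq> mcoeff 1 0" by (simp add: mcoeff_1)
    with eq show False by metis
  qed
  show "(f + g) * h = f * h + g * h"
    by (rule mfps_eqI) (simp add: mcoeff_mult distrib_right case_prod_unfold sum.distrib)
  show "f * g = g * f"
  proof (rule mfps_eqI)
    fix m :: "'a \<Rightarrow>\<^sub>0 nat"
    show "mcoeff (f * g) m = mcoeff (g * f) m"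
      unfolding mcoeff_mult
      by (rule sum.reindex_bij_witness[where i = prod.swap and j = prod.swap])
         (auto simp: splits_def add.commute mult.commute)
  qed
  show "1 * f = f"
  proof (rule mfps_eqI)
    fix m :: "'a \<Rightarrow>\<^sub>0 nat"
    have "mcoeff (1 * f) m = (\<Sum>(a, b)\<in>{(0, m)}. mcoeff (1 :: ('a, 'b) mfps) a * mcoeff f b)"
      unfolding mcoeff_mult
      by (rule sum.mono_neutral_right) (auto simp: mcoeff_1 split: if_splits)
    then show "mcoeff (1 * f) m = mcoeff f m" by (simp add: mcoeff_1)
  qed
  show "f * g * h = f * (g * h)"
  proof (rule mfps_eqI)
    fix m :: "'a \<Rightarrow>\<^sub>0 nat"
    have "mcoeff (f * g * h) m =
        (\<Sum>(p, c)\<in>splits m. \<Sum>(a, b)\<in>splits p. mcoeff f a * mcoeff g b * mcoeff h c)"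
      by (simp add: mcoeff_mult sum_distrib_right case_prod_unfold)
    also have "\<dots> = (\<Sum>((p, c), (a, b))\<in>(SIGMA z:splits m. splits (fst z)).
        mcoeff f a * mcoeff g b * mcoeff h c)"
      by (subst sum.Sigma[symmetric]) (auto simp: case_prod_unfold)
    also have "\<dots> = (\<Sum>((a, q), (b, c))\<in>(SIGMA z:splits m. splits (snd z)).
        mcoeff f a * (mcoeff g b * mcoeff h c))"
      by (rule sum.reindex_bij_witness
            [where i = "\<lambda>((a, q), (b, c)). ((a + b, c), (a, b))"
               and j = "\<lambda>((p, c), (a, b)). ((a, b + c), (b, c))"])
         (auto simp: splits_def add.assoc mult.assoc)
    also have "\<dots> = (\<Sum>(a, q)\<in>splits m. \<Sum>(b, c)\<in>splits q. mcoeff f a * (mcoeff g b * mcoeff h c))"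
      by (subst sum.Sigma[symmetric]) (auto simp: case_prod_unfold)
    also have "\<dots> = mcoeff (f * (g * h)) m"
      by (simp add: mcoeff_mult sum_distrib_left case_prod_unfold)
    finally show "mcoeff (f * g * h) m = mcoeff (f * (g * h)) m" .
  qed
qed

text \<open>
  Two nonempty sets of exponent vectors contain vectors \<open>a\<close>, \<open>b\<close> whose sum, as far as the finite
  set \<open>V\<close> of variables is concerned, arises in only one way. This yields a nonvanishing coefficient
  in a product of nonzero series.
\<close>

lemma unique_sum_on_finite:
  fixes A B :: "('v \<Rightarrow>\<^sub>0 nat) set"
  assumes "finite V" "A \<noteq> {}" "B \<noteq> {}"
  shows "\<exists>a\<in>A. \<exists>b\<in>B. \<forall>p\<in>A. \<forall>q\<in>B.
           (\<forall>v\<in>V. Poly_Mapping.lookup p v + Poly_Mapping.lookup q v = Poly_Mapping.lookup a v + Poly_Mapping.lookup b v) \<longrightarrow>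
           (\<forall>v\<in>V. Poly_Mapping.lookup p v = Poly_Mapping.lookup a v \<and> Poly_Mapping.lookup q v = Poly_Mapping.lookup b v)"
  using assms
proof (induction V arbitrary: A B rule: finite_induct)
  case empty
  then show ?case by auto
next
  case (insert v V)
  obtain a0 where a0: "a0 \<in> A" "\<And>p. p \<in> A \<Longrightarrow> Poly_Mapping.lookup a0 v \<le> Poly_Mapping.lookup p v"
    using insert.prems(1) arg_min_nat_lemma[of "\<lambda>p. p \<in> A" _ "\<lambda>p. Poly_Mapping.lookup p v"] by blast
  obtain b0 where b0: "b0 \<in> B" "\<And>q. q \<in> B \<Longrightarrow> Poly_Mapping.lookup b0 v \<le> Poly_Mapping.lookup q v"
    using insert.prems(2) arg_min_nat_lemma[of "\<lambda>p. p \<in> B" _ "\<lambda>p. Poly_Mapping.lookup p v"] by blast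
  define A' where "A' = {p \<in> A. Poly_Mapping.lookup p v = Poly_Mapping.lookup a0 v}"
  define B' where "B' = {q \<in> B. Poly_Mapping.lookup q v = Poly_Mapping.lookup b0 v}"
  have "A' \<noteq> {}" "B' \<noteq> {}" using a0 b0 by (auto simp: A'_def B'_def)
  from insert.IH[OF this] obtain a b where ab: "a \<in> A'" "b \<in> B'"
    and uniq: "\<And>p q. p \<in> A' \<Longrightarrow> q \<in> B' \<Longrightarrow>
           (\<forall>v\<in>V. Poly_Mapping.lookup p v + Poly_Mapping.lookup q v = Poly_Mapping.lookup a v + Poly_Mapping.lookup b v) \<Longrightarrow>
           (\<forall>v\<in>V. Poly_Mapping.lookup p v = Poly_Mapping.lookup a v \<and> Poly_Mapping.lookup q v = Poly_Mapping.lookup b v)"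
    by blast
  show ?case
  proof (rule bexI[of _ a], rule bexI[of _ b], intro ballI impI)
    show "a \<in> A" "b \<in> B" using ab by (auto simp: A'_def B'_def)
    fix p q w
    assume p: "p \<in> A" and q: "q \<in> B" and w: "w \<in> insert v V"
      and eq: "\<forall>v\<in>insert v V. Poly_Mapping.lookup p v + Poly_Mapping.lookup q v = Poly_Mapping.lookup a v + Poly_Mapping.lookup b v"
    have "Poly_Mapping.lookup p v + Poly_Mapping.lookup q v = Poly_Mapping.lookup a0 v + Poly_Mapping.lookup b0 v"
      using eq ab by (auto simp: A'_def B'_def)
    with a0(2)[OF p] b0(2)[OF q]
    have v: "Poly_Mapping.lookup p v = Poly_Mapping.lookup a0 v" "Poly_Mapping.lookup q v = Poly_Mapping.lookup b0 v" by linarith+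
    then have "p \<in> A'" "q \<in> B'" using p q by (auto simp: A'_def B'_def)
    with uniq eq have "\<forall>v\<in>V. Poly_Mapping.lookup p v = Poly_Mapping.lookup a v \<and> Poly_Mapping.lookup q v = Poly_Mapping.lookup b v" by blast
    then show "Poly_Mapping.lookup p w = Poly_Mapping.lookup a w \<and> Poly_Mapping.lookup q w = Poly_Mapping.lookup b w"
      using v w ab by (auto simp: A'_def B'_def)
  qed
qed

instance mfps :: (type, idom) idom
proof
  fix f g :: "('a, 'b) mfps"
  assume "f \<noteq> 0" "g \<noteq> 0"
  then obtain m n where m: "mcoeff f m \<noteq> 0" and n: "mcoeff g n \<noteq> 0"
    by (metis mcoeff_0 mfps_eqI)
  define V where "V = Poly_Mapping.keys m \<union> Poly_Mapping.keys n"
  define A where "A = {a. mcoeff f a \<noteq> 0 \<and> Poly_Mapping.keys a \<subseteq> V}"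
  define B where "B = {b. mcoeff g b \<noteq> 0 \<and> Poly_Mapping.keys b \<subseteq> V}"
  have "A \<noteq> {}" "B \<noteq> {}" "finite V" using m n by (auto simp: A_def B_def V_def)
  then obtain a b where ab: "a \<in> A" "b \<in> B" and uniq: "\<And>p q. p \<in> A \<Longrightarrow> q \<in> B \<Longrightarrow>
      (\<forall>v\<in>V. Poly_Mapping.lookup p v + Poly_Mapping.lookup q v = Poly_Mapping.lookup a v + Poly_Mapping.lookup b v) \<Longrightarrow>
      (\<forall>v\<in>V. Poly_Mapping.lookup p v = Poly_Mapping.lookup a v \<and> Poly_Mapping.lookup q v = Poly_Mapping.lookup b v)"
    using unique_sum_on_finite[of V A B] by blast
  have "(p, q) = (a, b)"
    if pq: "p + q = a + b" and nz: "mcoeff f p \<noteq> 0" "mcoeff g q \<noteq> 0" for p q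
  proof -
    have sum: "Poly_Mapping.lookup p v + Poly_Mapping.lookup q v = Poly_Mapping.lookup a v + Poly_Mapping.lookup b v" for v
      using pq by (metis lookup_add)
    have out: "Poly_Mapping.lookup a v = 0" "Poly_Mapping.lookup b v = 0" "Poly_Mapping.lookup p v = 0" "Poly_Mapping.lookup q v = 0" if "v \<notin> V" for v
    proof -
      show ab0: "Poly_Mapping.lookup a v = 0" "Poly_Mapping.lookup b v = 0"
        using ab that by (auto simp: A_def B_def in_keys_iff subset_iff)
      then show "Poly_Mapping.lookup p v = 0" "Poly_Mapping.lookup q v = 0" using sum[of v] by auto
    qed
    then have "p \<in> A" "q \<in> B" using nz unfolding A_def B_def
      by (metis (mono_tags, lifting) in_keys_iff mem_Collect_eq subsetI)+
    from uniq[OF this] sum have *: "\<forall>v\<in>V. Poly_Mapping.lookup p v = Poly_Mapping.lookup a v \<and> Poly_Mapping.lookup q v = Poly_Mapping.lookup b v" by blast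
    have "Poly_Mapping.lookup p v = Poly_Mapping.lookup a v" "Poly_Mapping.lookup q v = Poly_Mapping.lookup b v" for v
      using * out[of v] by (cases "v \<in> V"; simp)+
    then show ?thesis by (simp add: poly_mapping_eqI)
  qed
  then have only: "mcoeff f p * mcoeff g q = 0" if "p + q = a + b" "(p, q) \<noteq> (a, b)" for p q
    using that by (metis mult_eq_0_iff)
  have "mcoeff (f * g) (a + b) = (\<Sum>(p, q)\<in>{(a, b)}. mcoeff f p * mcoeff g q)"
    unfolding mcoeff_mult
  proof (rule sum.mono_neutral_right)
    show "\<forall>z\<in>splits (a + b) - {(a, b)}. (case z of (p, q) \<Rightarrow> mcoeff f p * mcoeff g q) = 0"
      using only by (intro ballI) (simp add: case_prod_unfold splits_def prod_eq_iff)
  qed auto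
  also have "\<dots> \<noteq> 0" using ab by (auto simp: A_def B_def)
  finally show "f * g \<noteq> 0" by auto
qed

text \<open>
  The topology of coefficientwise stabilisation, i.e. the product topology of the discrete
  topologies on the coefficients. It is the one in which infinite sums and products of
  power series are taken.
\<close>

instantiation mfps :: (type, type) t2_space
begin

definition open_mfps :: "('a, 'b) mfps set \<Rightarrow> bool" where
  "open_mfps S \<longleftrightarrow> (\<forall>f\<in>S. \<exists>M. finite M \<and> {g. \<forall>m\<in>M. mcoeff g m = mcoeff f m} \<subseteq> S)"

instance
proof
  show "open (UNIV :: ('a, 'b) mfps set)"
    by (auto simp: open_mfps_def)
next
  fix S T :: "('a, 'b) mfps set"
  assume S: "open S" and T: "open T"
  show "open (S \<inter> T)"
    unfolding open_mfps_def
  proof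
    fix f assume "f \<in> S \<inter> T"
    then obtain M N where "finite M" "{g. \<forall>m\<in>M. mcoeff g m = mcoeff f m} \<subseteq> S"
      "finite N" "{g. \<forall>m\<in>N. mcoeff g m = mcoeff f m} \<subseteq> T"
      using S T unfolding open_mfps_def by (meson IntE)
    then show "\<exists>M. finite M \<and> {g. \<forall>m\<in>M. mcoeff g m = mcoeff f m} \<subseteq> S \<inter> T"
      by (intro exI[of _ "M \<union> N"]) auto
  qed
next
  fix K :: "('a, 'b) mfps set set"
  assume "\<forall>S\<in>K. open S"
  then show "open (\<Union>K)"
    unfolding open_mfps_def by (meson UnionE Union_upper order_trans)
next
  fix f g :: "('a, 'b) mfps"
  assume "f \<noteq> g"
  then obtain m where m: "mcoeff f m \<noteq> mcoeff g m" by (metis mfps_eqI)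
  have "open {h. mcoeff h m = mcoeff k m}" for k :: "('a, 'b) mfps"
    unfolding open_mfps_def by (auto intro!: exI[of _ "{m}"])
  then show "\<exists>U V. open U \<and> open V \<and> f \<in> U \<and> g \<in> V \<and> U \<inter> V = {}"
    using m by (intro exI[of _ "{h. mcoeff h m = mcoeff f m}"] exI[of _ "{h. mcoeff h m = mcoeff g m}"]) auto
qed

end

lemma tendsto_mfps_iff:
  fixes F :: "'i \<Rightarrow> ('v, 'a) mfps"
  shows "(F \<longlongrightarrow> f) net \<longleftrightarrow> (\<forall>m. eventually (\<lambda>i. mcoeff (F i) m = mcoeff f m) net)"
proof
  assume lim: "(F \<longlongrightarrow> f) net"
  show "\<forall>m. eventually (\<lambda>i. mcoeff (F i) m = mcoeff f m) net"
  proof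
    fix m
    have "open {h. mcoeff h m = mcoeff f m}"
      unfolding open_mfps_def by (auto intro!: exI[of _ "{m}"])
    then show "eventually (\<lambda>i. mcoeff (F i) m = mcoeff f m) net"
      using topological_tendstoD[OF lim] by fastforce
  qed
next
  assume ev: "\<forall>m. eventually (\<lambda>i. mcoeff (F i) m = mcoeff f m) net"
  show "(F \<longlongrightarrow> f) net"
  proof (rule topological_tendstoI)
    fix S assume "open S" "f \<in> S"
    then obtain M where M: "finite M" "{g. \<forall>m\<in>M. mcoeff g m = mcoeff f m} \<subseteq> S"
      unfolding open_mfps_def by blast
    have "eventually (\<lambda>i. \<forall>m\<in>M. mcoeff (F i) m = mcoeff f m) net"
      using M(1) ev by (simp add: eventually_ball_finite)
    then show "eventually (\<lambda>i. F i \<in> S) net"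
      by eventually_elim (use M(2) in auto)
  qed
qed

text \<open>
  Quotients such as \<open>X\<^sub>n\<^sub>-\<^sub>1\<^sup>3 / X\<^sub>n\<close> live in the fraction field of the ring of power series.
  The following two notions say that all summands (factors) are power series, and that the infinite
  sum (product) of these power series is \<open>S\<close>; \<^const>\<open>to_fract\<close> is injective, so the series \<open>t i\<close>
  are determined by \<open>q\<close>.
\<close>

definition fract_has_sum ::
  "('i \<Rightarrow> ('v, 'a :: idom) mfps fract) \<Rightarrow> 'i set \<Rightarrow> ('v, 'a) mfps \<Rightarrow> bool" where
  "fract_has_sum q I S \<longleftrightarrow> (\<exists>t. (\<forall>i\<in>I. q i = to_fract (t i)) \<and> (t has_sum S) I)"

definition fract_has_prod_from_1 ::
  "(nat \<Rightarrow> ('v, 'a :: idom) mfps fract) \<Rightarrow> ('v, 'a) mfps \<Rightarrow> bool" where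
  "fract_has_prod_from_1 q P \<longleftrightarrow>
     (\<exists>t. (\<forall>i\<ge>1. q i = to_fract (t i)) \<and> (\<lambda>i. t (Suc i)) has_prod P)"


section \<open>Partitions\<close>

definition is_partition :: "nat list \<Rightarrow> bool" where
  "is_partition l \<longleftrightarrow> sorted_wrt (\<ge>) l \<and> (\<forall>p\<in>set l. p \<ge> 1)"

text \<open>The part \<open>\<lambda>\<^sub>i\<close>, for \<open>1 \<le> i \<le> length l\<close>.\<close>

definition part :: "nat list \<Rightarrow> nat \<Rightarrow> nat" where
  "part l i = l ! (i - 1)"

definition P1 :: "nat list set" where
  "P1 = {l. is_partition l \<and>
     (\<forall>i. 1 \<le> i \<and> i < length l \<longrightarrow> odd (part l (i + 1)) \<longrightarrow>
        int (part l i) - int (part l (i + 1)) \<ge> 3)}"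

definition P2 :: "nat list set" where
  "P2 = {l. is_partition l \<and> (\<forall>p\<in>set l. p \<ge> 2) \<and>
     (\<forall>i. 1 \<le> i \<and> i < length l \<longrightarrow> odd (part l i) \<longrightarrow>
        int (part l i) - int (part l (i + 1)) \<ge> 3)}"

definition P1' :: "nat list set" where
  "P1' = {l. is_partition l \<and> (\<forall>i. 1 \<le> i \<and> i \<le> length l \<longrightarrow> even i \<longrightarrow> even (part l i))}"

definition P2' :: "nat list set" where
  "P2' = {l. is_partition l \<and> (\<forall>i. 1 \<le> i \<and> i \<le> length l \<longrightarrow> odd i \<longrightarrow> even (part l i))}"


section \<open>The variables and the monomials\<close>

text \<open>
  The index type \<^typ>\<open>nat\<close> starts at 0, so \<open>x\<^sub>i\<close> (for \<open>i \<ge> 1\<close>) is the variable with index \<open>i - 1\<close>;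
  \<open>x\<^sub>0\<close> is never used.
\<close>

type_synonym pseries = "(nat, int) mfps"

definition var :: "nat \<Rightarrow> pseries" where
  "var i = Abs_mfps (\<lambda>m. if m = Poly_Mapping.single (i - 1) 1 then 1 else 0)"

definition part_monom :: "nat list \<Rightarrow> pseries" where
  "part_monom l = (\<Prod>i = 1..length l. var i ^ part l i)"

text \<open>
  \<open>X\<^sub>i\<close>, viewed in the fraction field. All indices in the identities below are at least 0, and
  \<open>X\<^sub>0 = 1\<close> is the empty product.
\<close>

definition X :: "nat \<Rightarrow> pseries fract" where
  "X n = to_fract (\<Prod>i = 1..n. var i)"

end

theory Submission
  imports Defs
begin

text \<open>
  Each of the four classes is described by a condition on consecutive parts that is invariant under
  adding 2 to all of them. Let \<open>F\<^sub>n\<close> be the generating function of the members of length at most \<open>n\<close>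
  and \<open>G\<^sub>n\<close> that of those which moreover have \<open>\<lambda>\<^sub>n\<close> even. Subtracting 2 from the first \<open>n\<close> parts as
  often as possible gives \<open>(1 - X\<^sub>n\<^sup>2) G\<^sub>n = F\<^sub>n\<^sub>-\<^sub>1\<close>. If odd \<open>\<lambda>\<^sub>n\<close> is permitted, the members with
  \<open>\<lambda>\<^sub>n\<close> odd are those with \<open>\<lambda>\<^sub>n\<close> even shifted by a fixed monomial \<open>c\<^sub>n = X\<^sub>n\<^sub>-\<^sub>1\<^sup>d X\<^sub>n\<^sup>\<gamma>\<close>, so that
  \<open>F\<^sub>n = (1 + c\<^sub>n) G\<^sub>n\<close>; otherwise \<open>F\<^sub>n = G\<^sub>n\<close>. Hence \<open>F\<^sub>n\<close> is the partial product of the infinite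
  product, and the series in the middle are the telescoping sums of \<open>F\<^sub>n - F\<^sub>n\<^sub>-\<^sub>1\<close> in the first two
  identities and of \<open>F\<^sub>2\<^sub>n - G\<^sub>2\<^sub>n\<^sub>-\<^sub>1\<close> and \<open>G\<^sub>2\<^sub>n\<^sub>+\<^sub>1 - F\<^sub>2\<^sub>n\<close> in the last two.
\<close>

section \<open>Indicator series of sets of monomials\<close>

text \<open>Coefficients 0 and 1 encode a multiplicity-free generating function, so that identities
  between series reduce to disjoint decompositions of sets of exponent vectors.\<close>

definition indicator_series :: "('v \<Rightarrow>\<^sub>0 nat) set \<Rightarrow> ('v, 'a :: zero_neq_one) mfps" where
  "indicator_series A = Abs_mfps (\<lambda>m. of_bool (m \<in> A))"

lemma mcoeff_indicator_series: "mcoeff (indicator_series A) m = of_bool (m \<in> A)"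
  by (simp add: indicator_series_def Abs_mfps_inverse)

lemma mcoeff_sum: "mcoeff (sum f A) m = (\<Sum>i\<in>A. mcoeff (f i) m)"
  by (induction A rule: infinite_finite_induct) auto

lemma indicator_series_0: "indicator_series {0} = 1"
  by (rule mfps_eqI) (simp add: mcoeff_indicator_series mcoeff_1)

lemma indicator_series_disjoint_Un:
  fixes A B :: "('v \<Rightarrow>\<^sub>0 nat) set"
  assumes "A \<inter> B = {}"
  shows "indicator_series (A \<union> B) =
    (indicator_series A + indicator_series B :: ('v, 'a :: comm_ring_1) mfps)"
  using assms by (intro mfps_eqI) (auto simp: mcoeff_indicator_series)

lemma indicator_series_Diff:
  fixes A B :: "('v \<Rightarrow>\<^sub>0 nat) set"
  assumes "B \<subseteq> A"
  shows "indicator_series (A - B) =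
    (indicator_series A - indicator_series B :: ('v, 'a :: comm_ring_1) mfps)"
  using assms by (intro mfps_eqI) (auto simp: mcoeff_indicator_series)

text \<open>In the convolution at \<open>m\<close> only the factorisation \<open>(a, m - a)\<close>
  can contribute, and only if \<open>m\<close> lies in the translate.\<close>

lemma indicator_series_translate:
  fixes A :: "('v \<Rightarrow>\<^sub>0 nat) set"
  shows "indicator_series ((+) a ` A) =
    (indicator_series {a} * indicator_series A :: ('v, 'a :: comm_ring_1) mfps)"
proof (rule mfps_eqI)
  fix m :: "'v \<Rightarrow>\<^sub>0 nat"
  define Z where "Z = (if m \<in> (+) a ` A then {(a, m - a)} else {})"
  have "mcoeff (indicator_series {a} * indicator_series A :: ('v, 'a) mfps) m =
      (\<Sum>(p, q)\<in>splits m. of_bool (p = a \<and> q \<in> A))"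
    by (simp add: mcoeff_mult mcoeff_indicator_series of_bool_conj)
  also have "\<dots> = (\<Sum>(p, q)\<in>Z. of_bool (p = a \<and> q \<in> A))"
    by (rule sum.mono_neutral_right) (auto simp: Z_def split: if_splits)
  also have "\<dots> = of_bool (m \<in> (+) a ` A)"
    by (auto simp: Z_def)
  finally show "mcoeff (indicator_series ((+) a ` A)) m =
      mcoeff (indicator_series {a} * indicator_series A :: ('v, 'a) mfps) m"
    by (simp add: mcoeff_indicator_series)
qed

lemma indicator_series_add:
  fixes a b :: "'v \<Rightarrow>\<^sub>0 nat"
  shows "indicator_series {a + b} =
    (indicator_series {a} * indicator_series {b} :: ('v, 'a :: comm_ring_1) mfps)"
  using indicator_series_translate[of a "{b}"] by simp

lemma indicator_series_sum:
  fixes a :: "'i \<Rightarrow> 'v \<Rightarrow>\<^sub>0 nat"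
  shows "indicator_series {\<Sum>i\<in>I. a i} =
    (\<Prod>i\<in>I. indicator_series {a i} :: ('v, 'a :: comm_ring_1) mfps)"
  by (induction I rule: infinite_finite_induct)
     (simp_all add: indicator_series_0 indicator_series_add)

lemma indicator_series_power:
  fixes a :: "'v \<Rightarrow>\<^sub>0 nat"
  shows "indicator_series {\<Sum>i<k. a} = (indicator_series {a} :: ('v, 'a :: comm_ring_1) mfps) ^ k"
  by (simp add: indicator_series_sum)

section \<open>Infinite sums and products of indicator series\<close>

lemma has_sum_indicator_series:
  fixes D :: "'i \<Rightarrow> ('v \<Rightarrow>\<^sub>0 nat) set"
  assumes "disjoint_family_on D I"
  shows "((\<lambda>i. indicator_series (D i) :: ('v, 'a :: comm_ring_1) mfps)
    has_sum indicator_series (\<Union>i\<in>I. D i)) I"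
  unfolding has_sum_def tendsto_mfps_iff
proof
  fix m
  define J where "J = {i \<in> I. m \<in> D i}"
  \<comment> \<open>By disjointness at most one index contributes to the coefficient of
    \<open>m\<close>; every finite index set containing \<open>J\<close> already gives the final
    coefficient.\<close>
  have "\<exists>i. J \<subseteq> {i}"
    using assms unfolding J_def disjoint_family_on_def by blast
  then have fin: "finite J" and card: "card J = of_bool (J \<noteq> {})"
    using finite_subset by (auto simp: subset_singleton_iff)
  have J: "m \<in> (\<Union>i\<in>I. D i) \<longleftrightarrow> J \<noteq> {}" by (auto simp: J_def)
  have "mcoeff (\<Sum>i\<in>Y. indicator_series (D i)) m =
      (mcoeff (indicator_series (\<Union>i\<in>I. D i)) m :: 'a)"
    if "finite Y" "J \<subseteq> Y" "Y \<subseteq> I" for Y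
  proof -
    have "mcoeff (\<Sum>i\<in>Y. indicator_series (D i)) m = (\<Sum>i\<in>Y. of_bool (m \<in> D i) :: 'a)"
      by (simp add: mcoeff_sum mcoeff_indicator_series)
    also have "\<dots> = (\<Sum>i\<in>J. of_bool (m \<in> D i))"
      using that by (intro sum.mono_neutral_right) (auto simp: J_def)
    also have "\<dots> = of_nat (card J)"
      by (simp add: J_def)
    also have "\<dots> = of_bool (J \<noteq> {})"
      by (simp add: card)
    finally show ?thesis
      unfolding mcoeff_indicator_series J .
  qed
  then show "\<forall>\<^sub>F Y in finite_subsets_at_top I.
      mcoeff (\<Sum>i\<in>Y. indicator_series (D i)) m =
      (mcoeff (indicator_series (\<Union>i\<in>I. D i)) m :: 'a)"
    unfolding eventually_finite_subsets_at_top
    using fin by (intro exI[of _ J]) (auto simp: J_def)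
qed

lemma fract_has_sum_indicator_series:
  fixes q :: "'i \<Rightarrow> ('v, 'a :: idom) mfps fract"
  assumes "disjoint_family_on D I"
    and "\<And>i. i \<in> I \<Longrightarrow> q i = to_fract (indicator_series (D i))"
  shows "fract_has_sum q I (indicator_series (\<Union>i\<in>I. D i))"
  unfolding fract_has_sum_def
  using assms has_sum_indicator_series[OF assms(1)]
  by (intro exI[of _ "\<lambda>i. indicator_series (D i)"]) simp

text \<open>Along an increasing chain a coefficient changes at most once, from 0 to 1.\<close>

lemma tendsto_indicator_series:
  fixes H :: "nat \<Rightarrow> ('v \<Rightarrow>\<^sub>0 nat) set"
  assumes "incseq H"
  shows "(\<lambda>n. indicator_series (H n) :: ('v, 'a :: comm_ring_1) mfps)
    \<longlonglongrightarrow> indicator_series (\<Union>n. H n)"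
  unfolding tendsto_mfps_iff
proof
  fix m
  show "\<forall>\<^sub>F n in sequentially. mcoeff (indicator_series (H n)) m =
      (mcoeff (indicator_series (\<Union>n. H n)) m :: 'a)"
  proof (cases "m \<in> (\<Union>n. H n)")
    case True
    then obtain k where "m \<in> H k" by blast
    then have "m \<in> H n" if "n \<ge> k" for n
      using incseqD[OF assms that] by blast
    then show ?thesis
      using True by (auto simp: mcoeff_indicator_series eventually_sequentially)
  qed (simp add: mcoeff_indicator_series)
qed

lemma fract_has_prod_from_1_indicator_series:
  fixes q :: "nat \<Rightarrow> ('v, 'a :: idom) mfps fract"
  assumes inc: "incseq H" and ne: "H 0 \<noteq> {}"
    and q: "\<And>i. i \<ge> 1 \<Longrightarrow> \<exists>t. q i = to_fract t"
    and prod: "\<And>n. (\<Prod>i = 1..n. q i) = to_fract (indicator_series (H n))"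
  shows "fract_has_prod_from_1 q (indicator_series (\<Union>n. H n))"
proof -
  obtain t where t: "q i = to_fract (t i)" if "i \<ge> 1" for i
    using q by metis
  have "to_fract (\<Prod>i = 1..n. t i) = (\<Prod>i = 1..n. q i)" for n
    by (induction n) (auto simp: t)
  \<comment> \<open>Injectivity of \<open>to_fract\<close> brings the product formula back to the
    ring of series.\<close>
  then have t_prod: "(\<Prod>i = 1..n. t i) = indicator_series (H n)" for n
    using prod by (metis to_fract_eq_iff)
  have "(\<Prod>i\<le>n. t (Suc i)) = indicator_series (H (Suc n))" for n
    by (simp only: t_prod[symmetric] One_nat_def atMost_atLeast0
        prod.atLeast_Suc_atMost_Suc_shift o_def)
  moreover have "(\<lambda>n. indicator_series (H (Suc n)) :: ('v, 'a) mfps)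
      \<longlonglongrightarrow> indicator_series (\<Union>n. H n)"
    using tendsto_indicator_series[OF inc] by (rule LIMSEQ_Suc)
  \<comment> \<open>\<open>raw_has_prod\<close> demands a nonzero limit; an element of
    \<open>H 0\<close> supplies a nonzero coefficient.\<close>
  moreover have "indicator_series (\<Union>n. H n) \<noteq> (0 :: ('v, 'a) mfps)"
  proof -
    obtain m where "m \<in> H 0" using ne by blast
    then have "mcoeff (indicator_series (\<Union>n. H n) :: ('v, 'a) mfps) m \<noteq> mcoeff 0 m"
      by (auto simp: mcoeff_indicator_series)
    then show ?thesis by metis
  qed
  ultimately show ?thesis
    unfolding fract_has_prod_from_1_def has_prod_def raw_has_prod_def
    using t by (intro exI[of _ t]) simp
qed

section \<open>Increments of an increasing chain of sets\<close>

lemma incseq_differences_disjoint: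
  assumes "incseq H" "i \<noteq> j"
  shows "(H (Suc i) - H i) \<inter> (H (Suc j) - H j) = {}"
proof -
  have "(H (Suc i) - H i) \<inter> (H (Suc j) - H j) = {}" if "i < j" for i j
    using incseqD[OF assms(1) Suc_leI[OF that]] by blast
  then show ?thesis
    using assms(2) by (metis inf_commute linorder_neqE_nat)
qed

text \<open>The injection \<open>k\<close> selects a subfamily of the increments, so that one chain
  can be divided among several series.\<close>

lemma disjoint_family_on_incseq_differences:
  assumes "incseq H" "inj_on k I"
  shows "disjoint_family_on (\<lambda>i. H (Suc (k i)) - H (k i)) I"
  using assms incseq_differences_disjoint[OF assms(1)]
  unfolding disjoint_family_on_def by (meson inj_onD)

lemma UN_incseq_differences: "(\<Union>n. H (Suc n) - H n) \<union> H 0 = (\<Union>n. H n)" for H :: "nat \<Rightarrow> 'b set"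
proof
  have "x \<in> (\<Union>n. H (Suc n) - H n) \<union> H 0" if "x \<in> H n" for x n
    using that by (induction n) auto
  then show "(\<Union>n. H n) \<subseteq> (\<Union>n. H (Suc n) - H n) \<union> H 0" by blast
qed auto

section \<open>Partitions as exponent vectors\<close>

lemma var_eq: "var i = indicator_series {Poly_Mapping.single (i - 1) 1}"
  by (simp add: var_def indicator_series_def of_bool_def)

text \<open>\<open>Poly_Mapping.nth l\<close> pads \<open>l\<close> with zeros; part
  \<open>i\<close> sits at position \<open>i - 1\<close>, which is the index behind
  \<open>var i\<close>.\<close>

lemma part_monom_eq: "part_monom l = indicator_series {Poly_Mapping.nth l}"
proof -
  have "part_monom l = indicator_series
      {\<Sum>i = 1..length l. \<Sum>k<part l i. Poly_Mapping.single (i - 1) 1}"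
    unfolding part_monom_def var_eq by (simp only: indicator_series_sum indicator_series_power prod_constant card_lessThan)
  also have "(\<Sum>i = 1..length l. \<Sum>k<part l i. Poly_Mapping.single (i - 1) 1) = Poly_Mapping.nth l"
  proof (rule poly_mapping_eqI)
    fix j
    have "(\<Sum>i = 1..length l. part l i * (1 when i - 1 = j)) =
        (\<Sum>i\<in>{1..length l} \<inter> {Suc j}. part l i * (1 when i - 1 = j))"
      by (rule sum.mono_neutral_right) (auto simp: when_def)
    also have "\<dots> = nth_default 0 l j"
      by (auto simp: nth_default_def part_def)
    finally show "Poly_Mapping.lookup
        (\<Sum>i = 1..length l. \<Sum>k<part l i. Poly_Mapping.single (i - 1) 1) j =
        Poly_Mapping.lookup (Poly_Mapping.nth l) j"
      unfolding lookup_sum lookup_single Poly_Mapping.lookup_nth by simp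
  qed
  finally show ?thesis .
qed

text \<open>All parts are positive, so there are no trailing zeros that the padding could
  hide.\<close>

lemma inj_on_nth_partitions: "inj_on Poly_Mapping.nth {l. is_partition l}"
proof (rule inj_onI)
  fix k l :: "nat list"
  assume "k \<in> {l. is_partition l}" "l \<in> {l. is_partition l}"
    and "Poly_Mapping.nth k = Poly_Mapping.nth l"
  moreover have "strip_while ((=) 0) l = l" if "is_partition l" for l :: "nat list"
  proof (cases l rule: rev_cases)
    case (snoc ys y)
    then show ?thesis using that by (auto simp: is_partition_def)
  qed simp
  ultimately show "k = l" by (simp add: Poly_Mapping.nth_eq_iff)
qed

text \<open>Zero padding makes the comparison after the last part automatic, so the order becomes a
  condition on consecutive entries, the shape in which the four classes are treated.\<close>

lemma is_partition_iff_antimono: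
  "is_partition l \<longleftrightarrow> (\<forall>i<length l. l ! i \<ge> 1) \<and>
    (\<forall>i. nth_default 0 l (Suc i) \<le> nth_default 0 l i)"
proof
  assume "is_partition l"
  then show "(\<forall>i<length l. l ! i \<ge> 1) \<and>
    (\<forall>i. nth_default 0 l (Suc i) \<le> nth_default 0 l i)"
    by (auto simp: is_partition_def nth_default_def sorted_wrt_iff_nth_less)
next
  assume *: "(\<forall>i<length l. l ! i \<ge> 1) \<and>
    (\<forall>i. nth_default 0 l (Suc i) \<le> nth_default 0 l i)"
  then have "nth_default 0 l j \<le> nth_default 0 l i" if "i \<le> j" for i j
    using lift_Suc_antimono_le[of "nth_default 0 l"] that by blast
  then have "l ! j \<le> l ! i" if "i < j" "j < length l" for i j
    using that by (metis less_imp_le nth_default_nth order.strict_trans)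
  with * show "is_partition l"
    by (auto simp: is_partition_def sorted_wrt_iff_nth_less in_set_conv_nth)
qed

text \<open>Finite support forces a zero; everything after the first zero vanishes by antitonicity,
  and the entries before it form the partition.\<close>

lemma antimono_is_nth_partition:
  fixes m :: "nat \<Rightarrow>\<^sub>0 nat"
  assumes "\<And>i. Poly_Mapping.lookup m (Suc i) \<le> Poly_Mapping.lookup m i"
  obtains l where "is_partition l" "Poly_Mapping.nth l = m"
proof -
  have anti: "Poly_Mapping.lookup m j \<le> Poly_Mapping.lookup m i" if "i \<le> j" for i j
    using lift_Suc_antimono_le[of "Poly_Mapping.lookup m"] assms that by blast
  obtain i where i: "Poly_Mapping.lookup m i = 0"
    by (metis ex_new_if_finite finite_keys in_keys_iff infinite_UNIV_nat)
  define n where "n = (LEAST i. Poly_Mapping.lookup m i = 0)"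
  have n: "Poly_Mapping.lookup m n = 0"
    unfolding n_def using i by (rule LeastI)
  have pos: "Poly_Mapping.lookup m i \<ge> 1" if "i < n" for i
    using not_less_Least[OF that[unfolded n_def]] by simp
  have zero: "Poly_Mapping.lookup m i = 0" if "i \<ge> n" for i
    using anti[OF that] n by simp
  define l where "l = map (Poly_Mapping.lookup m) [0..<n]"
  have l: "nth_default 0 l = Poly_Mapping.lookup m"
    using zero by (auto simp: l_def nth_default_def not_less)
  then have "Poly_Mapping.nth l = m"
    by (intro poly_mapping_eqI) simp
  moreover have "is_partition l"
    unfolding is_partition_iff_antimono l using assms pos by (simp add: l_def)
  ultimately show ?thesis using that by blast
qed

text \<open>Pairs inside the list give the conditions on consecutive parts, the last part paired
  with the padding gives the boundary clause, and all later pairs are \<open>(0, 0)\<close>.\<close>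

lemma all_nth_default_consecutive_iff:
  assumes "\<And>i. Q i 0 0"
  shows "(\<forall>i. Q i (nth_default 0 l i) (nth_default 0 l (Suc i))) \<longleftrightarrow>
    (\<forall>i. 1 \<le> i \<and> i < length l \<longrightarrow> Q (i - 1) (part l i) (part l (i + 1))) \<and>
    (l \<noteq> [] \<longrightarrow> Q (length l - 1) (last l) 0)"
  (is "?lhs \<longleftrightarrow> ?rhs")
proof
  assume L: ?lhs
  show ?rhs
  proof (intro conjI allI impI)
    fix i assume i: "1 \<le> i \<and> i < length l"
    then obtain k where "i = Suc k" by (cases i) auto
    with i show "Q (i - 1) (part l i) (part l (i + 1))"
      using L[rule_format, of k] by (simp add: nth_default_def part_def)
  next
    assume "l \<noteq> []"
    then show "Q (length l - 1) (last l) 0"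
      using L[rule_format, of "length l - 1"] by (simp add: nth_default_def last_conv_nth)
  qed
next
  assume R: ?rhs
  show ?lhs
  proof
    fix i
    consider "Suc i < length l" | "Suc i = length l" | "length l \<le> i" by linarith
    then show "Q i (nth_default 0 l i) (nth_default 0 l (Suc i))"
    proof cases
      case 1
      then show ?thesis
        using R[THEN conjunct1, rule_format, of "Suc i"] by (simp add: nth_default_def part_def)
    next
      case 2
      then have "l \<noteq> []" by auto
      then show ?thesis
        using 2 R[THEN conjunct2] by (simp add: nth_default_def last_conv_nth flip: 2)
    next
      case 3
      then show ?thesis by (simp add: nth_default_def assms)
    qed
  qed
qed

section \<open>The monomials \<open>X\<^sub>n\<close>\<close>

text \<open>The exponent vector of the monomial \<open>X n\<close>.\<close>

definition staircase :: "nat \<Rightarrow> nat \<Rightarrow>\<^sub>0 nat" where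
  "staircase n = (\<Sum>i<n. Poly_Mapping.single i 1)"

lemma lookup_staircase: "Poly_Mapping.lookup (staircase n) i = of_bool (i < n)"
  by (simp add: staircase_def lookup_sum lookup_single when_def)

lemma X_eq: "X n = to_fract (indicator_series {staircase n})"
proof -
  have "(\<Prod>i = 1..n. var i) = (\<Prod>i<n. indicator_series {Poly_Mapping.single i 1})"
    by (rule prod.reindex_bij_witness[of _ Suc "\<lambda>i. i - 1"]) (auto simp: var_eq)
  then show ?thesis
    by (simp add: X_def staircase_def indicator_series_sum)
qed

lemma indicator_series_eq_iff:
  "indicator_series A = (indicator_series B :: ('v, 'a :: zero_neq_one) mfps) \<longleftrightarrow> A = B"
proof
  assume eq: "indicator_series A = (indicator_series B :: ('v, 'a) mfps)"
  have "m \<in> A \<longleftrightarrow> m \<in> B" for m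
    using arg_cong[OF eq, of "\<lambda>f. mcoeff f m"]
    by (auto simp: mcoeff_indicator_series of_bool_def split: if_splits)
  then show "A = B" by blast
qed simp

lemma to_fract_power: "to_fract (f ^ k) = to_fract f ^ k"
  by (induction k) simp_all

lemma X_monomial: "X i ^ a * X j ^ b =
    to_fract (indicator_series {staircase i} ^ a * indicator_series {staircase j} ^ b)"
  by (simp add: X_eq to_fract_power)

lemma X_nonzero: "X n \<noteq> 0"
proof -
  have "indicator_series {staircase n} \<noteq> (indicator_series {} :: pseries)"
    by (simp add: indicator_series_eq_iff)
  moreover have "indicator_series {} = (0 :: pseries)"
    by (rule mfps_eqI) (simp add: mcoeff_indicator_series)
  ultimately show ?thesis by (simp add: X_eq)
qed

lemma X_square_eq: "X n ^ 2 = to_fract (indicator_series {staircase n + staircase n})"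
  by (simp add: X_eq indicator_series_add power2_eq_square)

lemma one_minus_X_square_nonzero: "n \<ge> 1 \<Longrightarrow> 1 - X n ^ 2 \<noteq> 0"
proof
  assume n: "n \<ge> 1" and "1 - X n ^ 2 = 0"
  then have "to_fract (indicator_series {staircase n + staircase n} :: pseries) =
      to_fract (indicator_series {0})"
    by (simp add: X_square_eq indicator_series_0)
  then have "staircase n + staircase n = 0"
    by (simp add: indicator_series_eq_iff)
  then have "Poly_Mapping.lookup (staircase n + staircase n) 0 = 0"
    by simp
  with n show False by (simp add: lookup_add lookup_staircase)
qed

text \<open>Geometric series: the set \<open>K\<close> of multiples of the exponent vector
  \<open>a\<close> of \<open>X n ^ 2\<close> is the disjoint union of \<open>{0}\<close> and its
  translate by \<open>a\<close>, so its series is inverse to \<open>1 - X n ^ 2\<close>.\<close>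

lemma inverse_one_minus_X_square:
  assumes "n \<ge> 1"
  shows "\<exists>t. 1 / (1 - X n ^ 2) = to_fract t"
proof
  define a where "a = staircase n + staircase n"
  define c where "c k = (\<Sum>i<k. a)" for k :: nat
  define K where "K = range c"
  have c: "c 0 = 0" "c (Suc k) = a + c k" for k
    by (simp_all only: c_def sum.lessThan_Suc lessThan_0 sum.empty add.commute)
  have "K = {0} \<union> (+) a ` K"
  proof -
    have "c k \<in> {0} \<union> (+) a ` K" for k
      by (cases k) (auto simp: K_def c)
    moreover have "a + c k \<in> K" "0 \<in> K" for k
      unfolding K_def by (metis c rangeI)+
    ultimately show ?thesis unfolding K_def by blast
  qed
  moreover have "{0} \<inter> (+) a ` K = {}"
  proof -
    \<comment> \<open>Since \<open>n \<ge> 1\<close>, the vector \<open>a\<close> has exponent 2 at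
      position 0, which keeps 0 out of the translate.\<close>
    have "Poly_Mapping.lookup (a + p) 0 \<noteq> 0" for p
      using assms by (simp add: a_def lookup_add lookup_staircase)
    then show ?thesis by (metis disjoint_iff imageE lookup_zero singletonD)
  qed
  ultimately have "indicator_series K =
      1 + indicator_series {a} * (indicator_series K :: pseries)"
    using indicator_series_disjoint_Un[of "{0}" "(+) a ` K"]
    by (simp add: indicator_series_0 indicator_series_translate)
  then have "(1 - indicator_series {a}) * (indicator_series K :: pseries) = 1"
    by (simp add: algebra_simps)
  then have "to_fract ((1 - indicator_series {a}) * (indicator_series K :: pseries)) = 1"
    by simp
  then have "(1 - X n ^ 2) * to_fract (indicator_series K) = 1"
    by (simp add: X_square_eq a_def)
  then show "1 / (1 - X n ^ 2) = to_fract (indicator_series K)"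
    using one_minus_X_square_nonzero[OF assms] by (simp add: field_simps)
qed

lemma one_plus_over_one_minus_X_square:
  assumes "n \<ge> 1"
  shows "\<exists>t. (1 + to_fract a) / (1 - X n ^ 2) = to_fract t"
proof -
  obtain t where t: "1 / (1 - X n ^ 2) = to_fract t"
    using inverse_one_minus_X_square[OF assms] by blast
  have "(1 + to_fract a) / (1 - X n ^ 2) = (1 + to_fract a) * (1 / (1 - X n ^ 2))"
    by simp
  also have "\<dots> = to_fract ((1 + a) * t)"
    unfolding t by simp
  finally show ?thesis ..
qed

section \<open>Partitions with local parity conditions\<close>

lemma lookup_add_diff:
  fixes a m :: "nat \<Rightarrow>\<^sub>0 nat"
  assumes "\<And>i. Poly_Mapping.lookup a i \<le> Poly_Mapping.lookup m i"
  shows "m = a + (m - a)"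
  using assms by (intro poly_mapping_eqI) (simp add: lookup_add lookup_minus)

text \<open>
  \<^term>\<open>R i\<close> constrains the pair of parts \<open>(\<lambda>\<^sub>i\<^sub>+\<^sub>1, \<lambda>\<^sub>i\<^sub>+\<^sub>2)\<close>, the partition being padded with zeros, and
  \<^term>\<open>act i\<close> says that \<open>\<lambda>\<^sub>i\<^sub>+\<^sub>1\<close> may be odd. In that case the admissible partitions of length at most
  \<open>i + 1\<close> with \<open>\<lambda>\<^sub>i\<^sub>+\<^sub>1\<close> odd arise from those with \<open>\<lambda>\<^sub>i\<^sub>+\<^sub>1\<close> even by multiplication with
  \<open>X\<^sub>i\<^sup>d X\<^sub>i\<^sub>+\<^sub>1\<^sup>\<gamma>\<close>.
\<close>

locale parity_ladder =
  fixes R :: "nat \<Rightarrow> nat \<Rightarrow> nat \<Rightarrow> bool" and act :: "nat \<Rightarrow> bool" and d \<gamma> :: nat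
  assumes R_antimono: "R i a b \<Longrightarrow> b \<le> a"
    and R_even_0: "even a \<Longrightarrow> R i a 0"
    and R_shift: "R i (a + 2) (b + 2) \<longleftrightarrow> R i a b"
    and odd_\<gamma>: "odd \<gamma>" and odd_d: "odd d"
    and R_inactive_0: "\<not> act i \<Longrightarrow> R i a 0 \<Longrightarrow> even a"
    and R_active_0: "act i \<Longrightarrow> odd a \<Longrightarrow> R i a 0 \<longleftrightarrow> \<gamma> \<le> a"
    and R_active_step: "act (Suc i) \<Longrightarrow> even b \<Longrightarrow> R i (a + (d + \<gamma>)) (b + \<gamma>) \<longleftrightarrow> R i a b"
    and R_active_le: "act (Suc i) \<Longrightarrow> odd b \<Longrightarrow> \<gamma> \<le> b \<Longrightarrow> R i a b \<Longrightarrow> d + \<gamma> \<le> a"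
begin

text \<open>Zero padding includes the pair formed by the last part and 0, so that boundary
  conditions are expressed by \<open>R\<close> as well.\<close>

definition admissible :: "(nat \<Rightarrow>\<^sub>0 nat) set" where
  "admissible = {m. \<forall>i. R i (Poly_Mapping.lookup m i) (Poly_Mapping.lookup m (Suc i))}"

definition admissible_upto :: "nat \<Rightarrow> (nat \<Rightarrow>\<^sub>0 nat) set" where
  "admissible_upto n = {m \<in> admissible. \<forall>i\<ge>n. Poly_Mapping.lookup m i = 0}"

text \<open>The exponent vectors counted by \<open>G\<^sub>n\<close>; the part
  \<open>\<lambda>\<^sub>n\<close> sits at position \<open>n - 1\<close>.\<close>

definition even_upto :: "nat \<Rightarrow> (nat \<Rightarrow>\<^sub>0 nat) set" where
  "even_upto n = {m \<in> admissible_upto n. even (Poly_Mapping.lookup m (n - 1))}"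

text \<open>The exponent vector of \<open>X j ^ d * X (Suc j) ^ \<gamma>\<close>.\<close>

definition step :: "nat \<Rightarrow> nat \<Rightarrow>\<^sub>0 nat" where
  "step j = (\<Sum>i<d. staircase j) + (\<Sum>i<\<gamma>. staircase (Suc j))"

lemma lookup_step:
  "Poly_Mapping.lookup (step j) i = (if i < j then d + \<gamma> else if i = j then \<gamma> else 0)"
  unfolding step_def lookup_add lookup_sum lookup_staircase by simp

lemma R_0_0: "R i 0 0"
  by (simp add: R_even_0)

text \<open>Applied to the common shift \<open>d + \<gamma>\<close>, which is even because both
  summands are odd.\<close>

lemma R_shift_even: "even k \<Longrightarrow> R i (a + k) (b + k) \<longleftrightarrow> R i a b"
proof -
  have "R i (a + 2 * l) (b + 2 * l) \<longleftrightarrow> R i a b" for l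
  proof (induction l)
    case (Suc l)
    then show ?case using R_shift[of i "a + 2 * l" "b + 2 * l"] by (simp add: add.assoc)
  qed simp
  then show "even k \<Longrightarrow> ?thesis" by (auto elim!: evenE)
qed

lemma admissible_antimono:
  assumes "m \<in> admissible" "i \<le> j"
  shows "Poly_Mapping.lookup m j \<le> Poly_Mapping.lookup m i"
  using assms R_antimono lift_Suc_antimono_le[of "Poly_Mapping.lookup m"]
  unfolding admissible_def by blast

text \<open>Pairs before \<open>j\<close> are shifted by 2 in both entries; the pair at
  \<open>j\<close> ends in 0 and has an even first entry before and after, so
  \<open>R_even_0\<close> settles it.\<close>

lemma admissible_add_staircase_iff:
  assumes "\<And>i. i > j \<Longrightarrow> Poly_Mapping.lookup m i = 0" "even (Poly_Mapping.lookup m j)"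
  shows "staircase (Suc j) + staircase (Suc j) + m \<in> admissible \<longleftrightarrow> m \<in> admissible"
proof -
  let ?f = "Poly_Mapping.lookup m"
  let ?g = "Poly_Mapping.lookup (staircase (Suc j) + staircase (Suc j) + m)"
  have g: "?g i = (if i \<le> j then ?f i + 2 else 0)" for i
    using assms(1) by (simp add: lookup_add lookup_staircase)
  have "R i (?g i) (?g (Suc i)) \<longleftrightarrow> R i (?f i) (?f (Suc i))" for i
  proof -
    consider "i < j" | "i = j" | "i > j" by linarith
    then show ?thesis
      by cases (use assms g R_shift R_even_0 in \<open>auto\<close>)
  qed
  then show ?thesis by (simp add: admissible_def)
qed

text \<open>Pairs ending before \<open>j\<close> shift by the even number
  \<open>d + \<gamma>\<close>; the pair ending at \<open>j\<close> is \<open>R_active_step\<close>;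
  the pair starting at \<open>j\<close> satisfies \<open>R\<close> in either case, by
  \<open>R_active_0\<close> after the shift and by \<open>R_even_0\<close> before it.\<close>

lemma admissible_add_step_iff:
  assumes "act j" "\<And>i. i > j \<Longrightarrow> Poly_Mapping.lookup m i = 0" "even (Poly_Mapping.lookup m j)"
  shows "step j + m \<in> admissible \<longleftrightarrow> m \<in> admissible"
proof -
  let ?f = "Poly_Mapping.lookup m"
  let ?g = "Poly_Mapping.lookup (step j + m)"
  have g: "?g i = (if i < j then ?f i + (d + \<gamma>) else if i = j then ?f i + \<gamma> else 0)" for i
    using assms(2) by (simp add: lookup_add lookup_step)
  have "R i (?g i) (?g (Suc i)) \<longleftrightarrow> R i (?f i) (?f (Suc i))" for i
  proof -
    consider "Suc i < j" | "Suc i = j" | "i = j" | "i > j" by linarith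
    then show ?thesis
    proof cases
      case 1
      then show ?thesis using odd_d odd_\<gamma> by (simp add: g R_shift_even)
    next
      case 2
      then have "act (Suc i)" "even (?f (Suc i))" using assms by auto
      then show ?thesis
        using 2 R_active_step[of i "?f (Suc i)" "?f i"] by (simp add: g)
    next
      case 3
      then show ?thesis
        using assms odd_\<gamma> R_active_0[of j "?f j + \<gamma>"] R_even_0[of "?f j" j] by (simp add: g)
    next
      case 4
      then show ?thesis using assms(2) by (simp add: g)
    qed
  qed
  then show ?thesis by (simp add: admissible_def)
qed

section \<open>Decompositions according to the last part\<close>

lemma upto_subset_even_upto: "admissible_upto j \<subseteq> even_upto (Suc j)"
  by (auto simp: even_upto_def admissible_upto_def)

lemma even_upto_subset_upto: "even_upto n \<subseteq> admissible_upto n"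
  by (auto simp: even_upto_def)

text \<open>An even exponent at \<open>j\<close> is 0 or at least 2; in the second case all earlier
  exponents are at least 2 as well, and one factor \<open>X (Suc j) ^ 2\<close> can be divided
  off.\<close>

lemma even_upto_Suc:
  "even_upto (Suc j) = admissible_upto j \<union> (+) (staircase (Suc j) + staircase (Suc j)) ` even_upto (Suc j)"
  (is "?G = _ \<union> (+) ?a ` _")
proof
  show "?G \<subseteq> admissible_upto j \<union> (+) ?a ` ?G"
  proof
    fix m assume m: "m \<in> ?G"
    then have adm: "m \<in> admissible" and zero: "\<And>i. i > j \<Longrightarrow> Poly_Mapping.lookup m i = 0"
      and ev: "even (Poly_Mapping.lookup m j)"
      by (auto simp: even_upto_def admissible_upto_def)
    show "m \<in> admissible_upto j \<union> (+) ?a ` ?G"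
    proof (cases "Poly_Mapping.lookup m j = 0")
      case True
      then have "m \<in> admissible_upto j"
        using adm zero by (auto simp: admissible_upto_def order_le_less)
      then show ?thesis ..
    next
      case False
      have "Poly_Mapping.lookup m i \<ge> 2" if "i \<le> j" for i
        using admissible_antimono[OF adm that] False ev by (cases "Poly_Mapping.lookup m j = 1") auto
      then have eq: "m = ?a + (m - ?a)"
        by (intro lookup_add_diff) (auto simp: lookup_add lookup_staircase less_Suc_eq_le numeral_2_eq_2)
      have zero': "Poly_Mapping.lookup (m - ?a) i = 0" if "i > j" for i
        using zero[OF that] by (simp add: lookup_minus)
      moreover have ev': "even (Poly_Mapping.lookup (m - ?a) j)"
        using ev by (simp add: lookup_minus lookup_add lookup_staircase)
      ultimately have "m - ?a \<in> admissible"
        using admissible_add_staircase_iff[of j "m - ?a"] adm eq by simp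
      then have "m - ?a \<in> ?G"
        using zero' ev' by (simp add: even_upto_def admissible_upto_def)
      then show ?thesis using eq by blast
    qed
  qed
next
  have "?a + m \<in> ?G" if "m \<in> ?G" for m
    using that admissible_add_staircase_iff[of j m]
    by (auto simp: even_upto_def admissible_upto_def lookup_add lookup_staircase)
  then show "admissible_upto j \<union> (+) ?a ` ?G \<subseteq> ?G"
    using upto_subset_even_upto by blast
qed

text \<open>An odd exponent at \<open>j\<close> is at least \<open>\<gamma>\<close>, and then the
  earlier ones are at least \<open>d + \<gamma>\<close>; subtracting \<open>step j\<close> makes it
  even, since \<open>\<gamma>\<close> is odd.\<close>

lemma upto_Suc_active:
  assumes "act j"
  shows "admissible_upto (Suc j) = even_upto (Suc j) \<union> (+) (step j) ` even_upto (Suc j)"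
  (is "?E = ?G \<union> _")
proof
  show "?E \<subseteq> ?G \<union> (+) (step j) ` ?G"
  proof
    fix m assume m: "m \<in> ?E"
    then have adm: "m \<in> admissible" and zero: "\<And>i. i > j \<Longrightarrow> Poly_Mapping.lookup m i = 0"
      by (auto simp: admissible_upto_def)
    show "m \<in> ?G \<union> (+) (step j) ` ?G"
    proof (cases "even (Poly_Mapping.lookup m j)")
      case True
      then show ?thesis using m by (simp add: even_upto_def)
    next
      case False
      have "R j (Poly_Mapping.lookup m j) 0"
        using adm zero[of "Suc j"] by (auto simp: admissible_def dest: spec[of _ j])
      then have \<gamma>: "\<gamma> \<le> Poly_Mapping.lookup m j"
        using R_active_0[OF assms False] by simp
      \<comment> \<open>\<open>R_active_le\<close> bounds only the immediate predecessor;
        monotonicity carries the bound to earlier positions.\<close>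
      have "d + \<gamma> \<le> Poly_Mapping.lookup m i" if ij: "i < j" for i
      proof -
        obtain k where k: "j = Suc k" "i \<le> k" using ij by (cases j) auto
        have "R k (Poly_Mapping.lookup m k) (Poly_Mapping.lookup m (Suc k))"
          using adm by (simp add: admissible_def)
        then have "d + \<gamma> \<le> Poly_Mapping.lookup m k"
          using R_active_le[of k] assms False \<gamma> k by blast
        then show ?thesis
          using admissible_antimono[OF adm k(2)] by simp
      qed
      with \<gamma> have eq: "m = step j + (m - step j)"
        by (intro lookup_add_diff) (auto simp: lookup_step)
      have zero': "Poly_Mapping.lookup (m - step j) i = 0" if "i > j" for i
        using zero[OF that] by (simp add: lookup_minus)
      moreover have ev': "even (Poly_Mapping.lookup (m - step j) j)"
        using False \<gamma> odd_\<gamma> by (simp add: lookup_minus lookup_step)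
      ultimately have "m - step j \<in> admissible"
        using admissible_add_step_iff[OF assms, of "m - step j"] adm eq by simp
      then have "m - step j \<in> ?G"
        using zero' ev' by (simp add: even_upto_def admissible_upto_def)
      then show ?thesis using eq by blast
    qed
  qed
next
  have "step j + m \<in> ?E" if "m \<in> ?G" for m
    using that admissible_add_step_iff[OF assms, of m]
    by (auto simp: even_upto_def admissible_upto_def lookup_add lookup_step)
  then show "?G \<union> (+) (step j) ` ?G \<subseteq> ?E"
    using even_upto_subset_upto by blast
qed

lemma upto_Suc_inactive:
  assumes "\<not> act j"
  shows "admissible_upto (Suc j) = even_upto (Suc j)"
proof -
  have "even (Poly_Mapping.lookup m j)" if "m \<in> admissible_upto (Suc j)" for m
  proof (rule R_inactive_0[OF assms])
    show "R j (Poly_Mapping.lookup m j) 0"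
      using that by (auto simp: admissible_upto_def admissible_def dest: spec[of _ j])
  qed
  then show ?thesis by (auto simp: even_upto_def)
qed

lemma upto_0: "admissible_upto 0 = {0}"
proof -
  have "0 \<in> admissible" by (simp add: admissible_def R_0_0)
  then show ?thesis by (auto simp: admissible_upto_def intro: poly_mapping_eqI)
qed

lemma UN_upto: "(\<Union>n. admissible_upto n) = admissible"
proof
  show "admissible \<subseteq> (\<Union>n. admissible_upto n)"
  proof
    fix m assume m: "m \<in> admissible"
    obtain n where "\<forall>i\<in>Poly_Mapping.keys m. i < n"
      using finite_nat_set_iff_bounded by (metis finite_keys)
    then have "\<forall>i\<ge>n. Poly_Mapping.lookup m i = 0"
      by (meson in_keys_iff leD)
    then show "m \<in> (\<Union>n. admissible_upto n)" using m by (auto simp: admissible_upto_def)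
  qed
qed (auto simp: admissible_upto_def)

lemma incseq_upto: "incseq admissible_upto"
  by (rule incseq_SucI) (meson upto_subset_even_upto even_upto_subset_upto order_trans)

section \<open>Recursions for the generating functions \<open>F\<^sub>n\<close> and
  \<open>G\<^sub>n\<close>\<close>

definition upto_gf :: "nat \<Rightarrow> pseries fract" where
  "upto_gf n = to_fract (indicator_series (admissible_upto n))"

definition even_upto_gf :: "nat \<Rightarrow> pseries fract" where
  "even_upto_gf n = to_fract (indicator_series (even_upto n))"

lemma upto_gf_0: "upto_gf 0 = 1"
  by (simp add: upto_gf_def upto_0 indicator_series_0)

text \<open>The union in \<open>even_upto_Suc\<close> is disjoint because the translation makes the
  exponent at \<open>j\<close> nonzero; the resulting linear equation is solved for
  \<open>even_upto_gf (Suc j)\<close>.\<close>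

lemma even_upto_gf_Suc: "even_upto_gf (Suc j) = upto_gf j / (1 - X (Suc j) ^ 2)"
proof -
  let ?a = "staircase (Suc j) + staircase (Suc j)"
  have "?a + p \<notin> admissible_upto j" for p
    by (auto simp: admissible_upto_def lookup_add lookup_staircase intro!: exI[of _ j])
  then have "admissible_upto j \<inter> (+) ?a ` even_upto (Suc j) = {}"
    by auto
  then have "indicator_series (even_upto (Suc j)) =
      indicator_series (admissible_upto j) +
      indicator_series {?a} * (indicator_series (even_upto (Suc j)) :: pseries)"
    by (subst even_upto_Suc)
       (simp add: indicator_series_disjoint_Un indicator_series_translate)
  then have "even_upto_gf (Suc j) = upto_gf j + X (Suc j) ^ 2 * even_upto_gf (Suc j)"
    unfolding even_upto_gf_def upto_gf_def X_square_eq
    by (metis to_fract_add to_fract_mult)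
  then have "even_upto_gf (Suc j) * (1 - X (Suc j) ^ 2) = upto_gf j"
    by (simp add: algebra_simps)
  then show ?thesis
    using one_minus_X_square_nonzero[of "Suc j"] by (simp add: eq_divide_eq)
qed

text \<open>The two pieces of \<open>upto_Suc_active\<close> are disjoint since their exponents at
  \<open>j\<close> have opposite parity.\<close>

lemma upto_gf_Suc_active:
  assumes "act j"
  shows "upto_gf (Suc j) = even_upto_gf (Suc j) * (1 + X j ^ d * X (Suc j) ^ \<gamma>)"
proof -
  have "odd (Poly_Mapping.lookup (step j + p) j)" if "p \<in> even_upto (Suc j)" for p
    using that odd_\<gamma> by (simp add: even_upto_def lookup_add lookup_step)
  then have "even_upto (Suc j) \<inter> (+) (step j) ` even_upto (Suc j) = {}"
    by (auto simp: even_upto_def)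
  then have "indicator_series (admissible_upto (Suc j)) =
      indicator_series (even_upto (Suc j)) +
      indicator_series {step j} * (indicator_series (even_upto (Suc j)) :: pseries)"
    by (simp add: upto_Suc_active[OF assms] indicator_series_disjoint_Un
        indicator_series_translate)
  then have "upto_gf (Suc j) =
      even_upto_gf (Suc j) + to_fract (indicator_series {step j}) * even_upto_gf (Suc j)"
    unfolding even_upto_gf_def upto_gf_def by (metis to_fract_add to_fract_mult)
  moreover have "to_fract (indicator_series {step j}) = X j ^ d * X (Suc j) ^ \<gamma>"
    by (simp only: step_def indicator_series_add indicator_series_power to_fract_mult
        to_fract_power X_eq)
  ultimately show ?thesis by (simp add: algebra_simps)
qed

lemma upto_gf_Suc_inactive: "\<not> act j \<Longrightarrow> upto_gf (Suc j) = even_upto_gf (Suc j)"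
  by (simp add: upto_gf_def even_upto_gf_def upto_Suc_inactive)

text \<open>Passage to exponent vectors is injective on partitions, and every admissible vector is
  reached because it is antitone; the monomials of \<open>P\<close> thus add up without
  repetition.\<close>

lemma has_sum_part_monom:
  assumes "P \<subseteq> {l. is_partition l}"
    and "\<And>l. is_partition l \<Longrightarrow> l \<in> P \<longleftrightarrow> Poly_Mapping.nth l \<in> admissible"
  shows "(part_monom has_sum indicator_series admissible) P"
proof -
  have "Poly_Mapping.nth ` P = admissible"
  proof
    show "admissible \<subseteq> Poly_Mapping.nth ` P"
    proof
      fix m assume m: "m \<in> admissible"
      then obtain l where "is_partition l" "Poly_Mapping.nth l = m"
        using antimono_is_nth_partition admissible_antimono by (metis lessI less_imp_le)
      then show "m \<in> Poly_Mapping.nth ` P" using m assms(2) by blast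
    qed
  qed (use assms in auto)
  moreover have "disjoint_family_on (\<lambda>l. {Poly_Mapping.nth l :: nat \<Rightarrow>\<^sub>0 nat}) P"
    using inj_on_subset[OF inj_on_nth_partitions assms(1)]
    by (auto simp: disjoint_family_on_def inj_on_def)
  then have "((\<lambda>l. indicator_series {Poly_Mapping.nth l} :: pseries) has_sum
      indicator_series (\<Union>l\<in>P. {Poly_Mapping.nth l})) P"
    by (rule has_sum_indicator_series)
  moreover have "part_monom = (\<lambda>l. indicator_series {Poly_Mapping.nth l})"
    by (simp add: fun_eq_iff part_monom_eq)
  ultimately show ?thesis by (simp add: UNION_singleton_eq_range)
qed

text \<open>With \<open>c\<close> the monomial \<open>X (n - 1) ^ d * X n ^ \<gamma>\<close>, the
  hypothesis on \<open>Y\<close> turns \<open>X n ^ 2 * (1 + Y n)\<close> into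
  \<open>(1 + c) - (1 - X n ^ 2)\<close>, the factor that arises in the difference of consecutive
  partial products.\<close>

lemma identity_all_active:
  assumes act: "\<And>j. act j"
    and Y: "\<And>n. n \<ge> 1 \<Longrightarrow> X n ^ 2 * Y n = X (n - 1) ^ d * X n ^ \<gamma>"
  shows "\<exists>A. fract_has_sum
      (\<lambda>n. (X n ^ 2 * (\<Prod>i = 1..n - 1. 1 + X (i - 1) ^ d * X i ^ \<gamma>) * (1 + Y n))
        / (\<Prod>i = 1..n. 1 - X i ^ 2)) {1..} A \<and>
    indicator_series admissible = 1 + A \<and>
    fract_has_prod_from_1 (\<lambda>i. (1 + X (i - 1) ^ d * X i ^ \<gamma>) / (1 - X i ^ 2))
      (indicator_series admissible)"
proof -
  let ?c = "\<lambda>i. X (i - 1) ^ d * X i ^ \<gamma>"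
  have gf_prod: "upto_gf n = (\<Prod>i = 1..n. (1 + ?c i) / (1 - X i ^ 2))" for n
  proof (induction n)
    case (Suc n)
    have "upto_gf (Suc n) = upto_gf n * ((1 + ?c (Suc n)) / (1 - X (Suc n) ^ 2))"
      by (simp add: upto_gf_Suc_active[OF act] even_upto_gf_Suc)
    then show ?case unfolding Suc.IH by simp
  qed (simp add: upto_gf_0)
  \<comment> \<open>\<open>D n\<close> collects the vectors of length exactly \<open>n + 1\<close>,
    so the summand with index \<open>n\<close> belongs to \<open>D (n - 1)\<close>.\<close>
  define D where "D n = admissible_upto (Suc n) - admissible_upto n" for n
  define A :: pseries where "A = indicator_series (\<Union>n\<in>{1..}. D (n - 1))"
  have "fract_has_sum (\<lambda>n. (X n ^ 2 * (\<Prod>i = 1..n - 1. 1 + ?c i) * (1 + Y n))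
      / (\<Prod>i = 1..n. 1 - X i ^ 2)) {1..} A"
    unfolding A_def
  proof (rule fract_has_sum_indicator_series)
    show "disjoint_family_on (\<lambda>n. D (n - 1)) {1..}"
      unfolding D_def
      by (rule disjoint_family_on_incseq_differences[OF incseq_upto]) (auto simp: inj_on_def)
  next
    fix n :: nat assume "n \<in> {1..}"
    then obtain k where k: "n = Suc k" by (cases n) auto
    define p where "p = (\<Prod>i = 1..k. 1 + ?c i)"
    define r where "r = (\<Prod>i = 1..k. 1 - X i ^ 2)"
    define s where "s = 1 - X n ^ 2"
    have gf: "upto_gf k = p / r"
      by (simp add: gf_prod prod_dividef p_def r_def)
    have s: "s \<noteq> 0" unfolding s_def k by (rule one_minus_X_square_nonzero) simp
    have "to_fract (indicator_series (D (n - 1))) = upto_gf n - upto_gf k"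
      by (simp add: D_def upto_gf_def k indicator_series_Diff incseq_SucD[OF incseq_upto])
    also have "upto_gf n = upto_gf k / s * (1 + ?c n)"
      by (simp add: k s_def upto_gf_Suc_active act even_upto_gf_Suc)
    \<comment> \<open>Both terms are multiples of \<open>upto_gf k / s\<close>, that is, of
      \<open>even_upto_gf n\<close>.\<close>
    also have "upto_gf k / s * (1 + ?c n) - upto_gf k = upto_gf k / s * ((1 + ?c n) - s)"
      using s by (simp add: field_simps)
    also have "(1 + ?c n) - s = X n ^ 2 * (1 + Y n)"
      using Y[of n] k by (simp add: s_def algebra_simps)
    also have "upto_gf k / s * (X n ^ 2 * (1 + Y n)) = (X n ^ 2 * p * (1 + Y n)) / (r * s)"
      by (simp add: gf)
    also have "r * s = (\<Prod>i = 1..n. 1 - X i ^ 2)"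
      by (simp add: r_def s_def k mult.commute)
    finally show "(X n ^ 2 * (\<Prod>i = 1..n - 1. 1 + ?c i) * (1 + Y n))
        / (\<Prod>i = 1..n. 1 - X i ^ 2) = to_fract (indicator_series (D (n - 1)))"
      by (simp add: p_def k)
  qed
  moreover have "indicator_series admissible = 1 + A"
  proof -
    have "n \<in> {1..} \<longleftrightarrow> n \<in> range Suc" for n
      by (cases n) auto
    then have "{1..} = range Suc" by blast
    then have "(\<Union>n\<in>{1..}. D (n - 1)) = (\<Union>n. admissible_upto (Suc n) - admissible_upto n)"
      by (simp add: D_def)
    then have "admissible = {0} \<union> (\<Union>n\<in>{1..}. D (n - 1))"
      using UN_incseq_differences[of admissible_upto] by (simp add: UN_upto upto_0 Un_commute)
    \<comment> \<open>The summand 1 is the empty partition, which lies in every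
      \<open>admissible_upto n\<close> and so in no increment.\<close>
    moreover have "{0} \<inter> (\<Union>n\<in>{1..}. D (n - 1)) = {}"
      using incseq_upto[THEN incseqD, of 0] by (auto simp: D_def upto_0)
    ultimately show ?thesis
      by (simp only: A_def indicator_series_disjoint_Un indicator_series_0)
  qed
  moreover have "fract_has_prod_from_1 (\<lambda>i. (1 + ?c i) / (1 - X i ^ 2))
      (indicator_series (\<Union>n. admissible_upto n))"
  proof (rule fract_has_prod_from_1_indicator_series)
    show "\<exists>t. (1 + ?c i) / (1 - X i ^ 2) = to_fract t" if "i \<ge> 1" for i
      using one_plus_over_one_minus_X_square[OF that] unfolding X_monomial by blast
  qed (use gf_prod incseq_upto in \<open>auto simp: upto_0 upto_gf_def\<close>)
  ultimately show ?thesis by (auto simp: UN_upto)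
qed

text \<open>The hypothesis \<open>step\<close> covers two positions at once, so that it does not
  depend on which of them may carry an odd part; \<open>c\<close> is the corresponding
  monomial.\<close>

lemma identity_double_step:
  assumes step: "\<And>n. upto_gf (2 * Suc n) = even_upto_gf (2 * n + 1) / (1 - X (2 * Suc n) ^ 2) * (1 + c (Suc n))"
    and c: "\<And>n. n \<ge> 1 \<Longrightarrow> \<exists>t. c n = to_fract t"
    and Y: "\<And>n. n \<ge> 1 \<Longrightarrow> X (2 * n) ^ 2 * Y n = c n"
  shows "\<exists>A B. fract_has_sum
      (\<lambda>n. (X (2 * n) ^ 2 * (\<Prod>i = 1..n - 1. 1 + c i) * (1 + Y n))
        / (\<Prod>i = 1..2 * n. 1 - X i ^ 2)) {1..} A \<and>
    fract_has_sum
      (\<lambda>n. (X (2 * n + 1) ^ 2 * (\<Prod>i = 1..n. 1 + c i))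
        / (\<Prod>i = 1..2 * n + 1. 1 - X i ^ 2)) {0..} B \<and>
    indicator_series admissible = 1 + A + B \<and>
    fract_has_prod_from_1 (\<lambda>i. (1 + c i) / ((1 - X (2 * i - 1) ^ 2) * (1 - X (2 * i) ^ 2)))
      (indicator_series admissible)"
proof -
  have even_gf: "even_upto_gf (2 * n + 1) = upto_gf (2 * n) / (1 - X (2 * n + 1) ^ 2)" for n
    by (simp add: even_upto_gf_Suc)
  have gf_prod: "upto_gf (2 * n) =
      (\<Prod>i = 1..n. (1 + c i) / ((1 - X (2 * i - 1) ^ 2) * (1 - X (2 * i) ^ 2)))" for n
  proof (induction n)
    case (Suc n)
    have "upto_gf (2 * Suc n) = upto_gf (2 * n) *
        ((1 + c (Suc n)) / ((1 - X (2 * Suc n - 1) ^ 2) * (1 - X (2 * Suc n) ^ 2)))"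
      unfolding step even_gf by simp
    then show ?case unfolding Suc.IH by simp
  qed (simp add: upto_gf_0)
  have gf: "upto_gf (2 * n) = (\<Prod>i = 1..n. 1 + c i) / (\<Prod>i = 1..2 * n. 1 - X i ^ 2)" for n
  proof -
    have "(\<Prod>i = 1..n. (1 - X (2 * i - 1) ^ 2) * (1 - X (2 * i) ^ 2)) =
        (\<Prod>i = 1..2 * n. 1 - X i ^ 2)"
      by (induction n) (simp_all add: mult.assoc)
    then show ?thesis by (simp add: gf_prod prod_dividef)
  qed
  \<comment> \<open>The increments of this interleaved chain are the summands of the two series.\<close>
  define H where "H k = (if even k then admissible_upto k else even_upto k)" for k
  have incseq_H: "incseq H"
  proof (rule incseq_SucI)
    \<comment> \<open>For odd \<open>k\<close> the inclusion runs from \<open>even_upto k\<close>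
      through \<open>admissible_upto k\<close> and \<open>even_upto (Suc k)\<close> to
      \<open>admissible_upto (Suc k)\<close>.\<close>
    fix k show "H k \<subseteq> H (Suc k)"
      using upto_subset_even_upto[of k] even_upto_subset_upto[of k] even_upto_subset_upto[of "Suc k"]
      unfolding H_def by (cases "even k") auto
  qed
  have H_0: "H 0 = {0}" by (simp add: H_def upto_0)
  have H_even: "H (2 * n) = admissible_upto (2 * n)" for n by (simp add: H_def)
  have H_odd: "H (2 * n + 1) = even_upto (2 * n + 1)" for n by (simp add: H_def)
  have UN_even: "(\<Union>n. admissible_upto (2 * n)) = admissible"
  proof -
    have "admissible_upto n \<subseteq> admissible_upto (2 * n)" for n
      using incseq_upto by (rule incseqD) simp
    then show ?thesis unfolding UN_upto[symmetric] by blast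
  qed
  have UN_H: "(\<Union>n. H n) = admissible"
  proof
    show "admissible \<subseteq> (\<Union>n. H n)" unfolding UN_even[symmetric] H_even[symmetric] by blast
    show "(\<Union>n. H n) \<subseteq> admissible"
      by (auto simp: H_def even_upto_def admissible_upto_def)
  qed
  define D where "D k = H (Suc k) - H k" for k
  \<comment> \<open>Increments from odd to even index form the first series, those from even to odd
    index the second; \<open>n \<ge> 1\<close> keeps \<open>2 * n - 1\<close> from being
    truncated.\<close>
  define A :: pseries where "A = indicator_series (\<Union>n\<in>{1..}. D (2 * n - 1))"
  define B :: pseries where "B = indicator_series (\<Union>n\<in>{0..}. D (2 * n))"
  have D_gf: "to_fract (indicator_series (D k)) =
      to_fract (indicator_series (H (Suc k))) - (to_fract (indicator_series (H k)) :: pseries fract)" for k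
    by (simp add: D_def indicator_series_Diff incseq_SucD[OF incseq_H])
  have "fract_has_sum (\<lambda>n. (X (2 * n) ^ 2 * (\<Prod>i = 1..n - 1. 1 + c i) * (1 + Y n))
      / (\<Prod>i = 1..2 * n. 1 - X i ^ 2)) {1..} A"
    unfolding A_def
  proof (rule fract_has_sum_indicator_series)
    show "disjoint_family_on (\<lambda>n. D (2 * n - 1)) {1..}"
      unfolding D_def
      by (rule disjoint_family_on_incseq_differences[OF incseq_H]) (auto simp: inj_on_def)
  next
    fix n :: nat assume "n \<in> {1..}"
    then obtain k where k: "n = Suc k" by (cases n) auto
    define p where "p = (\<Prod>i = 1..k. 1 + c i)"
    define r where "r = (\<Prod>i = 1..2 * k. 1 - X i ^ 2)"
    define u where "u = 1 - X (2 * k + 1) ^ 2"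
    define s where "s = 1 - X (2 * n) ^ 2"
    have s: "s \<noteq> 0" unfolding s_def k by (rule one_minus_X_square_nonzero) simp
    have g: "even_upto_gf (2 * k + 1) = p / (r * u)"
      unfolding even_gf gf p_def r_def u_def by simp
    have "to_fract (indicator_series (D (2 * n - 1))) = upto_gf (2 * n) - even_upto_gf (2 * k + 1)"
      unfolding D_gf using H_even[of n] H_odd[of k] by (simp add: k upto_gf_def even_upto_gf_def)
    also have "upto_gf (2 * n) = even_upto_gf (2 * k + 1) / s * (1 + c n)"
      unfolding k s_def by (rule step)
    also have "even_upto_gf (2 * k + 1) / s * (1 + c n) - even_upto_gf (2 * k + 1) =
        even_upto_gf (2 * k + 1) / s * ((1 + c n) - s)"
      using s by (simp add: field_simps)
    also have "(1 + c n) - s = X (2 * n) ^ 2 * (1 + Y n)"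
      using Y[of n] k by (simp add: s_def algebra_simps)
    also have "even_upto_gf (2 * k + 1) / s * (X (2 * n) ^ 2 * (1 + Y n)) =
        (X (2 * n) ^ 2 * p * (1 + Y n)) / (r * u * s)"
      unfolding g by simp
    also have "r * u * s = (\<Prod>i = 1..2 * n. 1 - X i ^ 2)"
      by (simp add: r_def s_def u_def k mult_ac)
    finally show "(X (2 * n) ^ 2 * (\<Prod>i = 1..n - 1. 1 + c i) * (1 + Y n))
        / (\<Prod>i = 1..2 * n. 1 - X i ^ 2) = to_fract (indicator_series (D (2 * n - 1)))"
      by (simp add: p_def k)
  qed
  moreover have "fract_has_sum (\<lambda>n. (X (2 * n + 1) ^ 2 * (\<Prod>i = 1..n. 1 + c i))
      / (\<Prod>i = 1..2 * n + 1. 1 - X i ^ 2)) {0..} B"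
    unfolding B_def
  proof (rule fract_has_sum_indicator_series)
    show "disjoint_family_on (\<lambda>n. D (2 * n)) {0..}"
      unfolding D_def
      by (rule disjoint_family_on_incseq_differences[OF incseq_H]) (auto simp: inj_on_def)
  next
    fix n :: nat
    define p where "p = (\<Prod>i = 1..n. 1 + c i)"
    define r where "r = (\<Prod>i = 1..2 * n. 1 - X i ^ 2)"
    define s where "s = 1 - X (2 * n + 1) ^ 2"
    have s: "s \<noteq> 0" unfolding s_def by (rule one_minus_X_square_nonzero) simp
    have "to_fract (indicator_series (D (2 * n))) = even_upto_gf (2 * n + 1) - upto_gf (2 * n)"
      unfolding D_gf using H_even[of n] H_odd[of n] by (simp add: upto_gf_def even_upto_gf_def)
    also have "\<dots> = upto_gf (2 * n) / s * (1 - s)"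
      using s unfolding even_gf s_def[symmetric] by (simp add: field_simps)
    also have "\<dots> = (X (2 * n + 1) ^ 2 * p) / (r * s)"
      by (simp add: gf p_def r_def s_def)
    also have "r * s = (\<Prod>i = 1..2 * n + 1. 1 - X i ^ 2)"
      by (simp add: r_def s_def mult.commute)
    finally show "(X (2 * n + 1) ^ 2 * (\<Prod>i = 1..n. 1 + c i))
        / (\<Prod>i = 1..2 * n + 1. 1 - X i ^ 2) = to_fract (indicator_series (D (2 * n)))"
      by (simp add: p_def)
  qed
  moreover have "indicator_series admissible = 1 + A + B"
  proof -
    let ?U = "\<Union>n\<in>{1..}. D (2 * n - 1)" and ?V = "\<Union>n\<in>{0..}. D (2 * n)"
    have "D k \<subseteq> ?U \<union> ?V" for k
    proof (cases "even k")
      case True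
      then obtain l where k: "k = 2 * l" by (elim evenE)
      show ?thesis unfolding k by (rule le_supI2, rule UN_upper) simp
    next
      case False
      then obtain l where "k = 2 * l + 1" by (elim oddE)
      then have k: "k = 2 * Suc l - 1" by simp
      show ?thesis unfolding k by (rule le_supI1, rule UN_upper) simp
    qed
    then have "(\<Union>k. D k) \<subseteq> ?U \<union> ?V" by (rule UN_least)
    moreover have "?U \<union> ?V \<subseteq> (\<Union>k. D k)"
      by (intro Un_least UN_least UN_upper UNIV_I)
    ultimately have UN_D: "(\<Union>k. D k) = ?U \<union> ?V" by (rule subset_antisym)
    have "admissible = (\<Union>k. D k) \<union> H 0"
      unfolding UN_H[symmetric] D_def by (rule UN_incseq_differences[symmetric])
    then have adm: "admissible = {0} \<union> (?U \<union> ?V)"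
      unfolding UN_D H_0 by (simp only: Un_commute)
    have "0 \<notin> D k" for k
      using incseqD[OF incseq_H, of 0 k] by (simp add: D_def H_0)
    then have zero: "{0} \<inter> (?U \<union> ?V) = {}" by simp
    have disj: "D (2 * i - 1) \<inter> D (2 * j) = {}" if "i \<in> {1..}" for i j
    proof -
      \<comment> \<open>For \<open>i = 0\<close> truncation would give 0, which is even;
        \<open>i \<ge> 1\<close> makes the left side odd.\<close>
      have "2 * i - 1 \<noteq> 2 * j" using that by simp presburger
      then show ?thesis unfolding D_def by (rule incseq_differences_disjoint[OF incseq_H])
    qed
    have "?U \<inter> ?V = {}"
    proof (rule equals0I)
      fix x assume "x \<in> ?U \<inter> ?V"
      then obtain i j where "i \<in> {1..}" "x \<in> D (2 * i - 1)" "x \<in> D (2 * j)"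
        by (elim IntE UN_E)
      with disj[of i j] show False by (simp add: disjoint_iff)
    qed
    then show ?thesis
      by (simp only: adm indicator_series_disjoint_Un[OF zero] indicator_series_disjoint_Un
          A_def B_def indicator_series_0 add.assoc)
  qed
  \<comment> \<open>Each factor covers two positions, so the partial products follow the
    even-indexed subchain.\<close>
  moreover have "fract_has_prod_from_1
      (\<lambda>i. (1 + c i) / ((1 - X (2 * i - 1) ^ 2) * (1 - X (2 * i) ^ 2)))
      (indicator_series (\<Union>n. admissible_upto (2 * n)))"
  proof (rule fract_has_prod_from_1_indicator_series)
    show "incseq (\<lambda>n. admissible_upto (2 * n))"
      by (rule incseq_SucI, rule incseqD[OF incseq_upto]) simp
    show "\<exists>t. (1 + c i) / ((1 - X (2 * i - 1) ^ 2) * (1 - X (2 * i) ^ 2)) = to_fract t"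
      if "i \<ge> 1" for i
    proof -
      obtain a where a: "c i = to_fract a" using c \<open>i \<ge> 1\<close> by blast
      obtain t where t: "(1 + to_fract a) / (1 - X (2 * i - 1) ^ 2) = to_fract t"
        using one_plus_over_one_minus_X_square[of "2 * i - 1" a] \<open>i \<ge> 1\<close> by fastforce
      obtain u where u: "1 / (1 - X (2 * i) ^ 2) = to_fract u"
        using inverse_one_minus_X_square[of "2 * i"] \<open>i \<ge> 1\<close> by fastforce
      have "(1 + c i) / ((1 - X (2 * i - 1) ^ 2) * (1 - X (2 * i) ^ 2)) =
          (1 + to_fract a) / (1 - X (2 * i - 1) ^ 2) * (1 / (1 - X (2 * i) ^ 2))"
        by (simp add: a)
      also have "\<dots> = to_fract (t * u)"
        unfolding t u by simp
      finally show ?thesis ..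
    qed
  qed (simp_all only: gf_prod[symmetric] upto_gf_def upto_0 mult_0_right, simp)
  ultimately show ?thesis unfolding UN_even by blast
qed

end

section \<open>The four classes\<close>

lemma nth_mem_admissible_iff:
  assumes "parity_ladder R act d \<gamma>" "is_partition l"
    and "\<And>i a b. R i a b \<longleftrightarrow> b \<le> a \<and> Q i a b"
  shows "Poly_Mapping.nth l \<in> parity_ladder.admissible R \<longleftrightarrow>
    (\<forall>i. Q i (nth_default 0 l i) (nth_default 0 l (Suc i)))"
  using assms(2) by (simp add: parity_ladder.admissible_def[OF assms(1)] assms(3) is_partition_iff_antimono)

lemma all_parts_iff:
  assumes "\<And>i. Q i 0"
  shows "(\<forall>i. Q i (nth_default 0 l i)) \<longleftrightarrow>
    (\<forall>i. 1 \<le> i \<and> i \<le> length l \<longrightarrow> Q (i - 1) (part l i))"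
proof
  assume R: "\<forall>i. 1 \<le> i \<and> i \<le> length l \<longrightarrow> Q (i - 1) (part l i)"
  show "\<forall>i. Q i (nth_default 0 l i)"
  proof
    fix i show "Q i (nth_default 0 l i)"
      using R[rule_format, of "Suc i"] assms by (auto simp: nth_default_def part_def)
  qed
next
  assume L: "\<forall>i. Q i (nth_default 0 l i)"
  show "\<forall>i. 1 \<le> i \<and> i \<le> length l \<longrightarrow> Q (i - 1) (part l i)"
  proof (intro allI impI)
    fix i assume "1 \<le> i \<and> i \<le> length l"
    then have "i - 1 < length l" by linarith
    then show "Q (i - 1) (part l i)"
      using L[rule_format, of "i - 1"] by (simp add: nth_default_def part_def)
  qed
qed

lemma int_diff_ge_3_iff: "int a - int b \<ge> 3 \<longleftrightarrow> b + 3 \<le> a"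
  by linarith

text \<open>An odd last part is at least 1 and a predecessor at least 3 larger, so the smallest
  shift is \<open>(4, ..., 4, 1)\<close>, which gives \<open>\<gamma> = 1\<close> and
  \<open>d = 3\<close>.\<close>

lemma parity_ladder_P1:
  "parity_ladder (\<lambda>i a b. b \<le> a \<and> (odd b \<longrightarrow> b + 3 \<le> a)) (\<lambda>i. True) 3 1"
  by standard presburger+

text \<open>Before the padding 0 an odd part is at least 3, and a predecessor of such a part is at
  least 4; the smallest shift \<open>(4, ..., 4, 3)\<close> gives \<open>\<gamma> = 3\<close> and
  \<open>d = 1\<close>.\<close>

lemma parity_ladder_P2:
  "parity_ladder (\<lambda>i a b. b \<le> a \<and> (odd a \<longrightarrow> b + 3 \<le> a)) (\<lambda>i. True) 1 3"
  by standard presburger+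

text \<open>Positions start at 0, so the odd-indexed parts, which may be odd, sit at even positions.
  A predecessor of such a part is even, so the smallest shift is
  \<open>(2, ..., 2, 1)\<close>.\<close>

lemma parity_ladder_P1':
  "parity_ladder (\<lambda>i a b. b \<le> a \<and> (odd i \<longrightarrow> even a)) even 1 1"
  by standard presburger+

lemma parity_ladder_P2':
  "parity_ladder (\<lambda>i a b. b \<le> a \<and> (even i \<longrightarrow> even a)) odd 1 1"
  by standard presburger+

section \<open>The identities for the four classes\<close>

lemma P1_identities:
  "\<exists>S A :: pseries.
    (part_monom has_sum S) P1 \<and>
    fract_has_sum
      (\<lambda>n. (X n ^ 2 * (\<Prod>i = 1..n - 1. 1 + X (i - 1) ^ 3 * X i) * (1 + X (n - 1) ^ 3 / X n))
           / (\<Prod>i = 1..n. 1 - X i ^ 2)) {1..} A \<and>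
    S = 1 + A \<and>
    fract_has_prod_from_1 (\<lambda>i. (1 + X (i - 1) ^ 3 * X i) / (1 - X i ^ 2)) S"
proof -
  interpret L: parity_ladder "\<lambda>i a b. b \<le> a \<and> (odd b \<longrightarrow> b + 3 \<le> a)" "\<lambda>i. True" 3 1
    by (rule parity_ladder_P1)
  have "(part_monom has_sum indicator_series L.admissible) P1"
  proof (rule L.has_sum_part_monom)
    fix l assume l: "is_partition l"
    have "Poly_Mapping.nth l \<in> L.admissible \<longleftrightarrow>
        (\<forall>i. odd (nth_default 0 l (Suc i)) \<longrightarrow> nth_default 0 l (Suc i) + 3 \<le> nth_default 0 l i)"
      by (rule nth_mem_admissible_iff[OF L.parity_ladder_axioms l]) simp
    \<comment> \<open>The boundary clause holds automatically, because the padding 0 is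
      even.\<close>
    also have "\<dots> \<longleftrightarrow> l \<in> P1"
      using all_nth_default_consecutive_iff[of "\<lambda>i a b. odd b \<longrightarrow> b + 3 \<le> a" l] l
      by (simp add: P1_def int_diff_ge_3_iff)
    finally show "l \<in> P1 \<longleftrightarrow> Poly_Mapping.nth l \<in> L.admissible" ..
  qed (auto simp: P1_def)
  moreover have "X n ^ 2 * (X (n - 1) ^ 3 / X n) = X (n - 1) ^ 3 * X n ^ 1" for n
    using X_nonzero[of n] by (simp add: power2_eq_square)
  note L.identity_all_active[OF TrueI this, unfolded power_one_right]
  ultimately show ?thesis by blast
qed

lemma P2_identities:
  "\<exists>S A :: pseries.
    (part_monom has_sum S) P2 \<and>
    fract_has_sum
      (\<lambda>n. (X n ^ 2 * (\<Prod>i = 1..n - 1. 1 + X (i - 1) * X i ^ 3) * (1 + X (n - 1) * X n))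
           / (\<Prod>i = 1..n. 1 - X i ^ 2)) {1..} A \<and>
    S = 1 + A \<and>
    fract_has_prod_from_1 (\<lambda>i. (1 + X (i - 1) * X i ^ 3) / (1 - X i ^ 2)) S"
proof -
  interpret L: parity_ladder "\<lambda>i a b. b \<le> a \<and> (odd a \<longrightarrow> b + 3 \<le> a)" "\<lambda>i. True" 1 3
    by (rule parity_ladder_P2)
  have "(part_monom has_sum indicator_series L.admissible) P2"
  proof (rule L.has_sum_part_monom)
    fix l assume l: "is_partition l"
    have "Poly_Mapping.nth l \<in> L.admissible \<longleftrightarrow>
        (\<forall>i. odd (nth_default 0 l i) \<longrightarrow> nth_default 0 l (Suc i) + 3 \<le> nth_default 0 l i)"
      by (rule nth_mem_admissible_iff[OF L.parity_ladder_axioms l]) simp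
    also have "\<dots> \<longleftrightarrow> (\<forall>i. 1 \<le> i \<and> i < length l \<longrightarrow> odd (part l i) \<longrightarrow>
          int (part l i) - int (part l (i + 1)) \<ge> 3) \<and> (l \<noteq> [] \<longrightarrow> odd (last l) \<longrightarrow> last l \<ge> 3)"
      using all_nth_default_consecutive_iff[of "\<lambda>i a b. odd a \<longrightarrow> b + 3 \<le> a" l]
      by (simp add: int_diff_ge_3_iff)
    \<comment> \<open>The last part is the smallest and is positive, so excluding 1 there excludes
      it everywhere.\<close>
    also have "(l \<noteq> [] \<longrightarrow> odd (last l) \<longrightarrow> last l \<ge> 3) \<longleftrightarrow> (\<forall>p\<in>set l. p \<ge> 2)"
    proof (cases l rule: rev_cases)
      case (snoc ys y)
      then have "y \<ge> 1" "\<forall>p\<in>set ys. y \<le> p"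
        using l by (auto simp: is_partition_def sorted_wrt_append)
      moreover have "(odd y \<longrightarrow> y \<ge> 3) \<longleftrightarrow> y \<ge> 2" if "y \<ge> 1"
        using that by presburger
      ultimately show ?thesis using snoc by auto
    qed simp
    finally show "l \<in> P2 \<longleftrightarrow> Poly_Mapping.nth l \<in> L.admissible"
      using l by (auto simp: P2_def)
  qed (auto simp: P2_def)
  moreover have "X n ^ 2 * (X (n - 1) * X n) = X (n - 1) ^ 1 * X n ^ 3" for n
    by (simp add: power2_eq_square power3_eq_cube)
  note L.identity_all_active[OF TrueI this, unfolded power_one_right]
  ultimately show ?thesis by blast
qed

lemma P1'_identities:
  "\<exists>S A B :: pseries.
    (part_monom has_sum S) P1' \<and>
    fract_has_sum
      (\<lambda>n. (X (2 * n) ^ 2 * (\<Prod>i = 1..n - 1. 1 + X (2 * i - 2) * X (2 * i - 1))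
              * (1 + X (2 * n - 2) * X (2 * n - 1) / X (2 * n) ^ 2))
           / (\<Prod>i = 1..2 * n. 1 - X i ^ 2)) {1..} A \<and>
    fract_has_sum
      (\<lambda>n. (X (2 * n + 1) ^ 2 * (\<Prod>i = 1..n. 1 + X (2 * i - 2) * X (2 * i - 1)))
           / (\<Prod>i = 1..2 * n + 1. 1 - X i ^ 2)) {0..} B \<and>
    S = 1 + A + B \<and>
    fract_has_prod_from_1
      (\<lambda>i. (1 + X (2 * i - 2) * X (2 * i - 1)) / ((1 - X (2 * i - 1) ^ 2) * (1 - X (2 * i) ^ 2))) S"
proof -
  interpret L: parity_ladder "\<lambda>i a b. b \<le> a \<and> (odd i \<longrightarrow> even a)" even 1 1
    by (rule parity_ladder_P1')
  have "(part_monom has_sum indicator_series L.admissible) P1'"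
  proof (rule L.has_sum_part_monom)
    fix l assume l: "is_partition l"
    have "Poly_Mapping.nth l \<in> L.admissible \<longleftrightarrow> (\<forall>i. odd i \<longrightarrow> even (nth_default 0 l i))"
      by (rule nth_mem_admissible_iff[OF L.parity_ladder_axioms l]) simp
    \<comment> \<open>Position \<open>i - 1\<close> is odd exactly if \<open>i\<close> is even,
      since \<open>i \<ge> 1\<close>.\<close>
    also have "\<dots> \<longleftrightarrow> (\<forall>i. 1 \<le> i \<and> i \<le> length l \<longrightarrow> even i \<longrightarrow> even (part l i))"
      unfolding all_parts_iff[of "\<lambda>i a. odd i \<longrightarrow> even a" l, simplified] by auto
    finally show "l \<in> P1' \<longleftrightarrow> Poly_Mapping.nth l \<in> L.admissible"
      using l by (simp add: P1'_def)
  qed (auto simp: P1'_def)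
  moreover have "X (2 * n) ^ 2 * (X (2 * n - 2) * X (2 * n - 1) / X (2 * n) ^ 2) =
      X (2 * n - 2) * X (2 * n - 1)" for n
    using X_nonzero[of "2 * n"] by simp
  note L.identity_double_step[OF _ _ this]
  moreover have "\<exists>t. X (2 * n - 2) * X (2 * n - 1) = to_fract t" for n
    using X_monomial[of "2 * n - 2" 1 "2 * n - 1" 1, unfolded power_one_right] by blast
  \<comment> \<open>Position \<open>2 * n\<close> is active and \<open>2 * n + 1\<close> is not, so
    the numerator arises in the first of the two steps.\<close>
  moreover have "L.upto_gf (2 * Suc n) = L.even_upto_gf (2 * n + 1) / (1 - X (2 * Suc n) ^ 2) *
      (1 + X (2 * Suc n - 2) * X (2 * Suc n - 1))" for n
    using L.upto_gf_Suc_active[of "2 * n"] L.upto_gf_Suc_inactive[of "2 * n + 1"]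
    by (simp add: L.even_upto_gf_Suc)
  ultimately show ?thesis by blast
qed

lemma P2'_identities:
  "\<exists>S A B :: pseries.
    (part_monom has_sum S) P2' \<and>
    fract_has_sum
      (\<lambda>n. (X (2 * n) ^ 2 * (\<Prod>i = 1..n - 1. 1 + X (2 * i - 1) * X (2 * i))
              * (1 + X (2 * n - 1) / X (2 * n)))
           / (\<Prod>i = 1..2 * n. 1 - X i ^ 2)) {1..} A \<and>
    fract_has_sum
      (\<lambda>n. (X (2 * n + 1) ^ 2 * (\<Prod>i = 1..n. 1 + X (2 * i - 1) * X (2 * i)))
           / (\<Prod>i = 1..2 * n + 1. 1 - X i ^ 2)) {0..} B \<and>
    S = 1 + A + B \<and>
    fract_has_prod_from_1
      (\<lambda>i. (1 + X (2 * i - 1) * X (2 * i)) / ((1 - X (2 * i - 1) ^ 2) * (1 - X (2 * i) ^ 2))) S"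
proof -
  interpret L: parity_ladder "\<lambda>i a b. b \<le> a \<and> (even i \<longrightarrow> even a)" odd 1 1
    by (rule parity_ladder_P2')
  have "(part_monom has_sum indicator_series L.admissible) P2'"
  proof (rule L.has_sum_part_monom)
    fix l assume l: "is_partition l"
    have "Poly_Mapping.nth l \<in> L.admissible \<longleftrightarrow> (\<forall>i. even i \<longrightarrow> even (nth_default 0 l i))"
      by (rule nth_mem_admissible_iff[OF L.parity_ladder_axioms l]) simp
    also have "\<dots> \<longleftrightarrow> (\<forall>i. 1 \<le> i \<and> i \<le> length l \<longrightarrow> odd i \<longrightarrow> even (part l i))"
      unfolding all_parts_iff[of "\<lambda>i a. even i \<longrightarrow> even a" l, simplified] by auto
    finally show "l \<in> P2' \<longleftrightarrow> Poly_Mapping.nth l \<in> L.admissible"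
      using l by (simp add: P2'_def)
  qed (auto simp: P2'_def)
  moreover have "X (2 * n) ^ 2 * (X (2 * n - 1) / X (2 * n)) = X (2 * n - 1) * X (2 * n)" for n
    using X_nonzero[of "2 * n"] by (simp add: power2_eq_square)
  note L.identity_double_step[OF _ _ this]
  moreover have "\<exists>t. X (2 * n - 1) * X (2 * n) = to_fract t" for n
    using X_monomial[of "2 * n - 1" 1 "2 * n" 1, unfolded power_one_right] by blast
  \<comment> \<open>Here the second of the two steps contributes the numerator.\<close>
  moreover have "L.upto_gf (2 * Suc n) = L.even_upto_gf (2 * n + 1) / (1 - X (2 * Suc n) ^ 2) *
      (1 + X (2 * Suc n - 1) * X (2 * Suc n))" for n
    using L.upto_gf_Suc_inactive[of "2 * n"] L.upto_gf_Suc_active[of "2 * n + 1"]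
    by (simp add: L.even_upto_gf_Suc)
  ultimately show ?thesis by blast
qed

theorem theorem1p7:
  shows
    "(\<exists>S A :: pseries.
        (part_monom has_sum S) P1 \<and>
        fract_has_sum
          (\<lambda>n. (X n ^ 2 * (\<Prod>i = 1..n - 1. 1 + X (i - 1) ^ 3 * X i) * (1 + X (n - 1) ^ 3 / X n))
               / (\<Prod>i = 1..n. 1 - X i ^ 2)) {1..} A \<and>
        S = 1 + A \<and>
        fract_has_prod_from_1 (\<lambda>i. (1 + X (i - 1) ^ 3 * X i) / (1 - X i ^ 2)) S)
     \<and>
     (\<exists>S A :: pseries.
        (part_monom has_sum S) P2 \<and>
        fract_has_sum
          (\<lambda>n. (X n ^ 2 * (\<Prod>i = 1..n - 1. 1 + X (i - 1) * X i ^ 3) * (1 + X (n - 1) * X n))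
               / (\<Prod>i = 1..n. 1 - X i ^ 2)) {1..} A \<and>
        S = 1 + A \<and>
        fract_has_prod_from_1 (\<lambda>i. (1 + X (i - 1) * X i ^ 3) / (1 - X i ^ 2)) S)
     \<and>
     (\<exists>S A B :: pseries.
        (part_monom has_sum S) P1' \<and>
        fract_has_sum
          (\<lambda>n. (X (2 * n) ^ 2 * (\<Prod>i = 1..n - 1. 1 + X (2 * i - 2) * X (2 * i - 1))
                  * (1 + X (2 * n - 2) * X (2 * n - 1) / X (2 * n) ^ 2))
               / (\<Prod>i = 1..2 * n. 1 - X i ^ 2)) {1..} A \<and>
        fract_has_sum
          (\<lambda>n. (X (2 * n + 1) ^ 2 * (\<Prod>i = 1..n. 1 + X (2 * i - 2) * X (2 * i - 1)))
               / (\<Prod>i = 1..2 * n + 1. 1 - X i ^ 2)) {0..} B \<and>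
        S = 1 + A + B \<and>
        fract_has_prod_from_1
          (\<lambda>i. (1 + X (2 * i - 2) * X (2 * i - 1)) / ((1 - X (2 * i - 1) ^ 2) * (1 - X (2 * i) ^ 2))) S)
     \<and>
     (\<exists>S A B :: pseries.
        (part_monom has_sum S) P2' \<and>
        fract_has_sum
          (\<lambda>n. (X (2 * n) ^ 2 * (\<Prod>i = 1..n - 1. 1 + X (2 * i - 1) * X (2 * i))
                  * (1 + X (2 * n - 1) / X (2 * n)))
               / (\<Prod>i = 1..2 * n. 1 - X i ^ 2)) {1..} A \<and>
        fract_has_sum
          (\<lambda>n. (X (2 * n + 1) ^ 2 * (\<Prod>i = 1..n. 1 + X (2 * i - 1) * X (2 * i)))
               / (\<Prod>i = 1..2 * n + 1. 1 - X i ^ 2)) {0..} B \<and>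
        S = 1 + A + B \<and>
        fract_has_prod_from_1
          (\<lambda>i. (1 + X (2 * i - 1) * X (2 * i)) / ((1 - X (2 * i - 1) ^ 2) * (1 - X (2 * i) ^ 2))) S)"
  by (intro conjI P1_identities P2_identities P1'_identities P2'_identities)

end
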